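(* Let $L$ be a finitely generated Lie algebra over a field $F$ and let $M$ be a finitely generated subalgebra of $L$. Let $U(M)$ be the universal enveloping algebra of $M$, naturally embedded in the universal enveloping algebra $U(L)$ of $L$. Then $$\mathrm{dist}_{U(L)}^{U(M)}=\overline{\,\mathrm{dist}_{L}^{M}\,},$$ that is, if a function $f:\mathbb{N}\to\mathbb{N}$ represents the equivalence class $\mathrm{dist}_L^M$, then the superadditive closure $\overline{f}$ represents the equivalence class $\mathrm{dist}_{U(L)}^{U(M)}$.
   Context: For functions $f,g:\mathbb{N}\to\mathbb{N}$ write $f\preceq g$ if there is a natural number $t$ with $f(n)\le t\,g(tn)$ for all $n\in\mathbb{N}$; $f$ and $g$ are equivalent if $f\preceq g$ and $g\preceq f$. Denote by $[f]$ the equivalence class of $f$. Degree filtrations: for a Lie algebra $L$ with finite generating set $X$, $L_n$ is the span of all commutators (arbitrary bracketing) of length at most $n$ in elements of $X$, $L_0=0$; for a unital associative algebra $A$ with finite generating set $X$, $A_n$ is the span of all products of at most $n$ elements of $X$, $A_0=F\cdot 1$. For a finitely generated subalgebra $B$ of a finitely generated algebra $A$ (Lie or unital associative), with degree filtrations $\{B_n\}$ and $\{A_n\}$, $\mathrm{dist}_A^B$ denotes the equivalence class of the function $n\mapsto\min\{m\mid B\cap A_n\subset B_m\}$; it does not depend on the choice of finite generating sets. The superadditive closure of $f:\mathbb{N}\to\mathbb{N}$ is $\overline{f}(n)=\max\{f(n_1)+\cdots+f(n_t)\mid n_1+\cdots+n_t=n\}$, the maximum being over all partitions of $n$ into positive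 integers $n_i$ (with $\overline{f}(0)=0$); it is the least function majorating $f$ with $\overline{f}(m)+\overline{f}(n)\le\overline{f}(m+n)$. If $f\preceq g$ then $\overline f\preceq\overline g$, so $\overline{[f]}:=[\overline f]$ is well defined. *)

theory Defs
  imports
    Complex_Main
    "HOL-Library.Poly_Mapping"
    "HOL-Algebra.QuotRing"
    "HOL-Algebra.Module"
begin

section \<open>Growth classes and superadditive closure\<close>

definition func_le :: "(nat \<Rightarrow> nat) \<Rightarrow> (nat \<Rightarrow> nat) \<Rightarrow> bool" where
  "func_le f g \<longleftrightarrow> (\<exists>t. \<forall>n. f n \<le> t * g (t * n))"

definition func_equiv :: "(nat \<Rightarrow> nat) \<Rightarrow> (nat \<Rightarrow> nat) \<Rightarrow> bool" where
  "func_equiv f g \<longleftrightarrow> func_le f g \<and> func_le g f"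

definition func_class :: "(nat \<Rightarrow> nat) \<Rightarrow> (nat \<Rightarrow> nat) set" where
  "func_class f = {g. func_equiv f g}"

text \<open>The set is finite and, for \<open>n = 0\<close>, comes from the empty list only.\<close>

definition superadd_closure :: "(nat \<Rightarrow> nat) \<Rightarrow> nat \<Rightarrow> nat" where
  "superadd_closure f n =
     Max {sum_list (map f ns) | ns. (\<forall>k\<in>set ns. 0 < k) \<and> sum_list ns = n}"

definition class_closure :: "(nat \<Rightarrow> nat) set \<Rightarrow> (nat \<Rightarrow> nat) set" where
  "class_closure C = (\<Union>f\<in>C. func_class (superadd_closure f))"

definition distortion :: "(nat \<Rightarrow> 'a set) \<Rightarrow> 'a set \<Rightarrow> (nat \<Rightarrow> 'a set) \<Rightarrow> nat \<Rightarrow> nat" where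
  "distortion A_filt B B_filt n = (LEAST m. B \<inter> A_filt n \<subseteq> B_filt m)"


section \<open>Unital associative algebras\<close>

text \<open>
  Algebras that are quotients need a carrier, so they are records of type \<^type>\<open>module\<close>;
  the scalars form a type of class \<^class>\<open>field\<close>.
\<close>

definition assoc_subspace :: "('f::field, 'a) module \<Rightarrow> 'a set \<Rightarrow> bool" where
  "assoc_subspace A W \<longleftrightarrow>
     subgroup W (add_monoid A) \<and> (\<forall>c. \<forall>x\<in>W. c \<odot>\<^bsub>A\<^esub> x \<in> W)"

definition assoc_subalgebra :: "('f::field, 'a) module \<Rightarrow> 'a set \<Rightarrow> bool" where
  "assoc_subalgebra A B \<longleftrightarrow> assoc_subspace A B \<and> submonoid B A"

definition assoc_generates :: "('f::field, 'a) module \<Rightarrow> 'a set \<Rightarrow> 'a set \<Rightarrow> bool" where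
  "assoc_generates A X B \<longleftrightarrow> assoc_subalgebra A hull X = B"

definition assoc_filt :: "('f::field, 'a) module \<Rightarrow> 'a set \<Rightarrow> nat \<Rightarrow> 'a set" where
  "assoc_filt A X n =
     assoc_subspace A hull
       {foldr (mult A) xs \<one>\<^bsub>A\<^esub> | xs. set xs \<subseteq> X \<and> length xs \<le> n}"

text \<open>
  The class of the distortion function is independent of the finite generating sets, so the
  union below is a single class if \<open>A\<close> and \<open>B\<close> are finitely generated.
\<close>

definition assoc_dist :: "('f::field, 'a) module \<Rightarrow> 'a set \<Rightarrow> (nat \<Rightarrow> nat) set" where
  "assoc_dist A B =
     \<Union>{func_class (distortion (assoc_filt A X) B (assoc_filt A Y)) | X Y.
         finite X \<and> assoc_generates A X (carrier A) \<and>
         finite Y \<and> assoc_generates A Y B}"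


section \<open>Free associative algebras\<close>

text \<open>
  Words form an additively written monoid under concatenation, so the convolution product on
  finitely supported functions on words is that of the free unital associative algebra.
\<close>

datatype 'a free_word = Word (letters: "'a list")

instantiation free_word :: (type) monoid_add
begin

definition zero_free_word :: "'a free_word" where
  "0 = Word []"

definition plus_free_word :: "'a free_word \<Rightarrow> 'a free_word \<Rightarrow> 'a free_word" where
  "u + v = Word (letters u @ letters v)"

instance
  by standard (auto simp: zero_free_word_def plus_free_word_def)

end

definition gen :: "'a \<Rightarrow> ('a free_word \<Rightarrow>\<^sub>0 'f::field)" where
  "gen x = Poly_Mapping.single (Word [x]) 1"

definition fscale :: "'f::field \<Rightarrow> ('a free_word \<Rightarrow>\<^sub>0 'f) \<Rightarrow> ('a free_word \<Rightarrow>\<^sub>0 'f)" where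
  "fscale c p = Poly_Mapping.map ((*) c) p"

definition free_algebra :: "'a set \<Rightarrow> ('f::field, 'a free_word \<Rightarrow>\<^sub>0 'f) module" where
  "free_algebra S =
     \<lparr>carrier = {p. \<forall>w\<in>Poly_Mapping.keys p. set (letters w) \<subseteq> S},
      mult = (*), one = 1, zero = 0, add = (+), smult = fscale\<rparr>"


section \<open>Lie algebras and their universal enveloping algebras\<close>

locale lie_algebra = vector_space scale
  for scale :: "'f::field \<Rightarrow> 'l::ab_group_add \<Rightarrow> 'l" +
  fixes bracket :: "'l \<Rightarrow> 'l \<Rightarrow> 'l"
  assumes bracket_add_left: "bracket (x + y) z = bracket x z + bracket y z"
    and bracket_add_right: "bracket x (y + z) = bracket x y + bracket x z"
    and bracket_scale_left: "bracket (scale c x) y = scale c (bracket x y)"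
    and bracket_scale_right: "bracket x (scale c y) = scale c (bracket x y)"
    and bracket_self: "bracket x x = 0"
    and jacobi: "bracket x (bracket y z) + bracket y (bracket z x) + bracket z (bracket x y) = 0"
begin

definition lie_subalgebra :: "'l set \<Rightarrow> bool" where
  "lie_subalgebra M \<longleftrightarrow> subspace M \<and> (\<forall>x\<in>M. \<forall>y\<in>M. bracket x y \<in> M)"

definition lie_generates :: "'l set \<Rightarrow> 'l set \<Rightarrow> bool" where
  "lie_generates X M \<longleftrightarrow> lie_subalgebra hull X = M"

inductive lie_commutator :: "'l set \<Rightarrow> nat \<Rightarrow> 'l \<Rightarrow> bool" for X where
  generator: "x \<in> X \<Longrightarrow> lie_commutator X 1 x"
| bracket: "lie_commutator X m x \<Longrightarrow> lie_commutator X n y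
    \<Longrightarrow> lie_commutator X (m + n) (bracket x y)"

definition lie_filt :: "'l set \<Rightarrow> nat \<Rightarrow> 'l set" where
  "lie_filt X n = span {x. \<exists>k\<le>n. lie_commutator X k x}"

definition lie_dist :: "'l set \<Rightarrow> (nat \<Rightarrow> nat) set" where
  "lie_dist M =
     \<Union>{func_class (distortion (lie_filt X) M (lie_filt Y)) | X Y.
         finite X \<and> lie_generates X UNIV \<and> finite Y \<and> lie_generates Y M}"

text \<open>
  For a Lie subalgebra \<open>S\<close>, \<open>uea S\<close> is the quotient of the tensor algebra of \<open>S\<close> by the ideal
  generated by all \<open>x \<otimes> y - y \<otimes> x - [x,y]\<close>. The tensor algebra itself is the free algebra on
  the set \<open>S\<close> modulo the linear relations of \<open>S\<close>, which are the first two sets below.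
\<close>

definition uea_relations :: "'l set \<Rightarrow> ('l free_word \<Rightarrow>\<^sub>0 'f) set" where
  "uea_relations S =
     {gen (x + y) - (gen x + gen y) | x y. x \<in> S \<and> y \<in> S} \<union>
     {gen (scale c x) - fscale c (gen x) | c x. x \<in> S} \<union>
     {gen x * gen y - gen y * gen x - gen (bracket x y) | x y. x \<in> S \<and> y \<in> S}"

definition uea_ideal :: "'l set \<Rightarrow> ('l free_word \<Rightarrow>\<^sub>0 'f) set" where
  "uea_ideal S = Idl\<^bsub>free_algebra S\<^esub> (uea_relations S)"

definition uea_smult ::
    "'l set \<Rightarrow> 'f \<Rightarrow> ('l free_word \<Rightarrow>\<^sub>0 'f) set \<Rightarrow> ('l free_word \<Rightarrow>\<^sub>0 'f) set" where
  "uea_smult S c C = (\<Union>p\<in>C. uea_ideal S +>\<^bsub>free_algebra S\<^esub> fscale c p)"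

definition uea :: "'l set \<Rightarrow> ('f, ('l free_word \<Rightarrow>\<^sub>0 'f) set) module" where
  "uea S = ring.extend (free_algebra S Quot uea_ideal S) (module.fields (uea_smult S))"

text \<open>
  The natural homomorphism \<open>U(M) \<rightarrow> U(L)\<close>, induced by the inclusion of free algebras; it is
  injective by the Poincare-Birkhoff-Witt theorem.
\<close>

definition uea_embed :: "'l set \<Rightarrow> ('l free_word \<Rightarrow>\<^sub>0 'f) set \<Rightarrow> ('l free_word \<Rightarrow>\<^sub>0 'f) set" where
  "uea_embed M C = (\<Union>p\<in>C. uea_ideal UNIV +>\<^bsub>free_algebra UNIV\<^esub> p)"

definition uea_image :: "'l set \<Rightarrow> ('l free_word \<Rightarrow>\<^sub>0 'f) set set" where
  "uea_image M = uea_embed M ` carrier (uea M)"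

end

end

theory Submission
  imports Defs "HOL-Library.Multiset"
begin

text \<open>
  The image of \<open>U(M)\<close> in \<open>U(L)\<close> is the subalgebra generated by \<open>M\<close>, so the whole argument takes place
  inside \<open>U(L)\<close>. Fix finite generating sets \<open>X\<close> of \<open>L\<close> and \<open>Y\<close> of \<open>M\<close>, and let \<open>d(n)\<close> be the least
  \<open>m\<close> with \<open>M \<inter> L\<^sub>n \<subseteq> M\<^sub>m\<close>. For the degree filtrations of \<open>U(L)\<close> and \<open>U(M)\<close> with respect to the same
  generators \<open>X\<close> and \<open>Y\<close>, the distortion function is not only equivalent but equal to the superadditive
  closure of \<open>d\<close> (\<open>assoc_dist_uea_image\<close>). The equality of classes follows because neither class
  depends on the generators and because superadditive closure respects equivalence.

  The tool is the Poincare-Birkhoff-Witt theorem in the form of a projection. For a totally ordered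
  basis \<open>B\<close> of \<open>L\<close>, rewriting \<open>b a\<close> as \<open>a b + [b,a]\<close> whenever \<open>a \<prec> b\<close> defines a linear endomorphism \<open>pbw\<close> of
  the free algebra that vanishes on the defining ideal of \<open>U(L)\<close> (\<open>pbw_uea_ideal\<close>), is the identity modulo that ideal
  (\<open>pbw_congruent\<close>) and fixes the nondecreasing words in \<open>B\<close> (\<open>pbw_no_descent\<close>). Moreover, if \<open>V\<^sub>n\<close> is an
  increasing chain of subspaces with \<open>[V\<^sub>m, V\<^sub>n] \<subseteq> V\<^sub>m\<^sub>+\<^sub>n\<close> and each \<open>V\<^sub>n\<close> is spanned by \<open>B \<inter> V\<^sub>n\<close>, then the
  rewriting does not raise weights: a product of elements of \<open>V\<^sub>k\<close> for \<open>k = k\<^sub>1, \<dots>, k\<^sub>r\<close> has a normal form all of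
  whose words have weight at most \<open>k\<^sub>1 + \<dots> + k\<^sub>r\<close> (\<open>pbw_weighted\<close>). So, for a basis adapted to the filtrations
  in question, membership in \<open>U(M)\<close> or in a term of a degree filtration can be read off from the words
  of the normal form.

  Upper bound (\<open>uea_image_inter_filt_subset\<close>): take \<open>B\<close> adapted to the \<open>L\<^sub>n\<close> with \<open>B \<inter> M\<close> adapted to the
  \<open>M \<inter> L\<^sub>n\<close>. An element of \<open>U(M) \<inter> U(L)\<^sub>n\<close> is a combination of words in \<open>B \<inter> M\<close> whose letters have positive
  weights of sum at most \<open>n\<close>. A letter of weight \<open>k\<close> lies in \<open>M \<inter> L\<^sub>k\<close>, hence in \<open>M\<close> in degree \<open>d(k)\<close>, so the word
  lies in \<open>U(M)\<close> in a degree that is a sum of values of \<open>d\<close> over a partition of a number \<open>\<le> n\<close>.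

  Lower bound (\<open>superadd_closure_le_uea_degree\<close>): for every positive value \<open>v\<close> of \<open>d\<close> there is an element of
  \<open>M\<close> of exact degree \<open>v\<close> that lies in \<open>L\<^sub>k\<close> for all \<open>k\<close> with \<open>d(k) = v\<close>. Having distinct degrees, these elements belong to a
  common basis adapted to the filtration of \<open>M\<close>. For a partition of \<open>n\<close> into parts \<open>k\<close>, the sorted product of
  the elements chosen for the values \<open>d(k)\<close> lies in \<open>U(M) \<inter> U(L)\<^sub>n\<close> and is its own normal form, of weight
  the sum of the \<open>d(k)\<close>; therefore it lies in no smaller term of the filtration of \<open>U(M)\<close>.
\<close>

section \<open>Growth classes, superadditive closures and distortion functions\<close>

lemma func_leI: "(\<And>n. f n \<le> t * g (t * n)) \<Longrightarrow> func_le f g"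
  unfolding func_le_def by blast

lemma func_le_refl: "func_le f f"
  by (rule func_leI[of _ 1]) simp

lemma func_le_trans:
  assumes "func_le f g" "func_le g h"
  shows "func_le f h"
proof -
  obtain s t where s: "\<And>n. f n \<le> s * g (s * n)" and t: "\<And>n. g n \<le> t * h (t * n)"
    using assms unfolding func_le_def by blast
  have "f n \<le> (s * t) * h ((s * t) * n)" for n
  proof -
    have "f n \<le> s * g (s * n)" by (rule s)
    also have "\<dots> \<le> s * (t * h (t * (s * n)))" using t by (rule mult_le_mono2)
    finally show ?thesis by (simp add: ac_simps)
  qed
  then show ?thesis by (rule func_leI)
qed

lemma func_class_eqI:
  assumes "func_equiv f g"
  shows "func_class f = func_class g"
  using assms unfolding func_class_def func_equiv_def by (blast intro: func_le_trans)

lemma func_class_self: "f \<in> func_class f"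
  by (simp add: func_class_def func_equiv_def func_le_refl)

context
  fixes f :: "nat \<Rightarrow> nat"
begin

private lemma finite_partition_values:
  "finite {sum_list (map f ns) | ns. (\<forall>k\<in>set ns. 0 < k) \<and> sum_list ns = n}"
proof -
  have "length ns \<le> n \<and> set ns \<subseteq> {..n}" if "\<forall>k\<in>set ns. 0 < k" "sum_list ns = n" for ns :: "nat list"
    using that
  proof (induction ns arbitrary: n)
    case (Cons k ns)
    then have "length ns \<le> sum_list ns \<and> set ns \<subseteq> {..sum_list ns}" by simp
    with Cons.prems show ?case by auto
  qed simp
  then have "{ns. (\<forall>k\<in>set ns. 0 < k) \<and> sum_list ns = n} \<subseteq> {ns. set ns \<subseteq> {..n} \<and> length ns \<le> n}"
    by blast
  then have "finite {ns. (\<forall>k\<in>set ns. 0 < k) \<and> sum_list ns = n}"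
    by (rule finite_subset) (simp add: finite_lists_length_le)
  then have "finite ((\<lambda>ns. sum_list (map f ns)) ` {ns. (\<forall>k\<in>set ns. 0 < k) \<and> sum_list ns = n})"
    by (rule finite_imageI)
  then show ?thesis by (rule rev_finite_subset) blast
qed

lemma sum_le_superadd_closure:
  assumes "\<forall>k\<in>set ns. 0 < k" "sum_list ns = n"
  shows "sum_list (map f ns) \<le> superadd_closure f n"
  unfolding superadd_closure_def
  by (rule Max_ge[OF finite_partition_values]) (use assms in blast)

lemma superadd_closure_attained:
  obtains ns where "\<forall>k\<in>set ns. 0 < k" "sum_list ns = n" "superadd_closure f n = sum_list (map f ns)"
proof -
  have "(\<forall>k\<in>set (if n = 0 then [] else [n]). 0 < k) \<and> sum_list (if n = 0 then [] else [n]) = n" by simp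
  then have "{sum_list (map f ns) | ns. (\<forall>k\<in>set ns. 0 < k) \<and> sum_list ns = n} \<noteq> {}" by blast
  from Max_in[OF finite_partition_values this] show ?thesis
    using that unfolding superadd_closure_def by blast
qed

text \<open>Appending the difference of the two arguments to an optimal partition of the smaller one
  does not lower the sum of values.\<close>

lemma superadd_closure_mono:
  assumes "m \<le> n"
  shows "superadd_closure f m \<le> superadd_closure f n"
proof (cases "m = n")
  case False
  obtain ns where ns: "\<forall>k\<in>set ns. 0 < k" "sum_list ns = m" "superadd_closure f m = sum_list (map f ns)"
    by (rule superadd_closure_attained)
  have "sum_list (map f ((n - m) # ns)) \<le> superadd_closure f n"
    by (rule sum_le_superadd_closure) (use ns assms False in auto)
  with ns show ?thesis by simp
qed simp

end

text \<open>Multiplying all parts of a partition of \<open>n\<close> by \<open>t\<close> gives a partition of \<open>t * n\<close>.\<close>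

lemma func_le_superadd_closure:
  assumes "func_le f g"
  shows "func_le (superadd_closure f) (superadd_closure g)"
proof -
  obtain t where t: "\<And>n. f n \<le> t * g (t * n)"
    using assms unfolding func_le_def by blast
  have "superadd_closure f n \<le> t * superadd_closure g (t * n)" for n
  proof -
    obtain ns where ns: "\<forall>k\<in>set ns. 0 < k" "sum_list ns = n" "superadd_closure f n = sum_list (map f ns)"
      by (rule superadd_closure_attained)
    have "sum_list (map f ns) \<le> t * sum_list (map g (map ((*) t) ns))"
    proof (induction ns)
      case (Cons k ns)
      then show ?case using t[of k] by (simp add: distrib_left add_mono)
    qed simp
    also have "\<dots> \<le> t * superadd_closure g (t * n)"
    proof (cases "t = 0")
      case False
      have "sum_list (map g (map ((*) t) ns)) \<le> superadd_closure g (t * n)"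
        by (rule sum_le_superadd_closure)
          (use ns False in \<open>auto simp: sum_list_const_mult\<close>)
      then show ?thesis by simp
    qed simp
    finally show ?thesis by (simp add: ns)
  qed
  then show ?thesis by (rule func_leI)
qed

lemma func_equiv_superadd_closure:
  "func_equiv f g \<Longrightarrow> func_equiv (superadd_closure f) (superadd_closure g)"
  unfolding func_equiv_def by (blast intro: func_le_superadd_closure)

lemma distortionI:
  assumes "B \<inter> A n \<subseteq> Bf k"
  shows "B \<inter> A n \<subseteq> Bf (distortion A B Bf n)"
  unfolding distortion_def using assms by (rule LeastI)

lemma distortion_least:
  assumes "B \<inter> A n \<subseteq> Bf m"
  shows "distortion A B Bf n \<le> m"
  unfolding distortion_def using assms by (rule Least_le)

text \<open>This is what makes distortion independent of the generators: degree filtrations for different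
  finite generating sets are contained in each other after a linear change of the index.\<close>

lemma distortion_func_le:
  assumes A: "\<And>n. A n \<subseteq> A' (c * n)" and B: "\<And>n. B' n \<subseteq> Bf (e * n)"
    and finite: "\<And>n. \<exists>m. B \<inter> A' n \<subseteq> B' m"
    and mono: "\<And>m n. m \<le> n \<Longrightarrow> A' m \<subseteq> A' n"
  shows "func_le (distortion A B Bf) (distortion A' B B')"
proof -
  define t where "t = max c e"
  have "distortion A B Bf n \<le> t * distortion A' B B' (t * n)" for n
  proof -
    obtain k where "B \<inter> A' (t * n) \<subseteq> B' k" using finite by blast
    then have "B \<inter> A' (t * n) \<subseteq> B' (distortion A' B B' (t * n))" by (rule distortionI)
    also have "\<dots> \<subseteq> Bf (e * distortion A' B B' (t * n))" by (rule B)
    finally have "B \<inter> A' (t * n) \<subseteq> Bf (e * distortion A' B B' (t * n))" .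
    moreover have "A n \<subseteq> A' (t * n)"
      using A[of n] mono[of "c * n" "t * n"] by (auto simp: t_def)
    ultimately have "B \<inter> A n \<subseteq> Bf (e * distortion A' B B' (t * n))" by blast
    then have "distortion A B Bf n \<le> e * distortion A' B B' (t * n)" by (rule distortion_least)
    also have "\<dots> \<le> t * distortion A' B B' (t * n)" by (simp add: t_def)
    finally show ?thesis .
  qed
  then show ?thesis by (rule func_leI)
qed

section \<open>Algebras given as quotients of a ring\<close>

text \<open>The enveloping algebra lives on a carrier of cosets, where the algebra of type classes is not
  available. Its quotient map \<open>\<pi>\<close> starts from a type, so spans, products and degree filtrations are
  computed upstairs and pushed forward along \<open>\<pi>\<close>.\<close>

locale algebra_presentation = vector_space sc
  for sc :: "'f::field \<Rightarrow> 'r::ring_1 \<Rightarrow> 'r" +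
  fixes A :: "('f, 'a) module" and \<pi> :: "'r \<Rightarrow> 'a"
  assumes sc_mult_left: "sc c x * y = sc c (x * y)"
    and sc_mult_right: "x * sc c y = sc c (x * y)"
    and carrier_eq: "carrier A = range \<pi>"
    and \<pi>_add: "\<pi> (x + y) = \<pi> x \<oplus>\<^bsub>A\<^esub> \<pi> y"
    and \<pi>_zero: "\<pi> 0 = \<zero>\<^bsub>A\<^esub>"
    and \<pi>_mult: "\<pi> (x * y) = \<pi> x \<otimes>\<^bsub>A\<^esub> \<pi> y"
    and \<pi>_one: "\<pi> 1 = \<one>\<^bsub>A\<^esub>"
    and \<pi>_scale: "\<pi> (sc c x) = c \<odot>\<^bsub>A\<^esub> \<pi> x"
begin

lemma add_group: "group (add_monoid A)"
proof (rule groupI)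
  fix x assume "x \<in> carrier (add_monoid A)"
  then obtain p where p: "x = \<pi> p" using carrier_eq by auto
  have "\<pi> (- p) \<oplus>\<^bsub>A\<^esub> \<pi> p = \<zero>\<^bsub>A\<^esub>"
    by (simp flip: \<pi>_add \<pi>_zero)
  then show "\<exists>y\<in>carrier (add_monoid A). y \<otimes>\<^bsub>add_monoid A\<^esub> x = \<one>\<^bsub>add_monoid A\<^esub>"
    using p carrier_eq by auto
qed (auto simp: carrier_eq add.assoc simp flip: \<pi>_add \<pi>_zero)

lemma inv_add: "inv\<^bsub>add_monoid A\<^esub> \<pi> x = \<pi> (- x)"
  by (rule group.inv_equality[OF add_group]) (auto simp: carrier_eq simp flip: \<pi>_add \<pi>_zero)

lemma assoc_subspace_iff:
  "assoc_subspace A W \<longleftrightarrow> W \<subseteq> range \<pi> \<and> subspace (\<pi> -` W)"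
proof
  assume W: "assoc_subspace A W"
  then have sg: "subgroup W (add_monoid A)" by (simp add: assoc_subspace_def)
  have "W \<subseteq> range \<pi>" using subgroup.subset[OF sg] by (simp add: carrier_eq)
  moreover have "subspace (\<pi> -` W)"
    using subgroup.m_closed[OF sg] subgroup.one_closed[OF sg] W
    by (intro subspaceI) (auto simp: \<pi>_add \<pi>_zero \<pi>_scale assoc_subspace_def)
  ultimately show "W \<subseteq> range \<pi> \<and> subspace (\<pi> -` W)" ..
next
  assume "W \<subseteq> range \<pi> \<and> subspace (\<pi> -` W)"
  then have sub: "W \<subseteq> range \<pi>" and ss: "subspace (\<pi> -` W)" by auto
  have "subgroup W (add_monoid A)"
  proof
    show "W \<subseteq> carrier (add_monoid A)" using sub by (simp add: carrier_eq)
    show "\<one>\<^bsub>add_monoid A\<^esub> \<in> W" using subspace_0[OF ss] by (simp add: \<pi>_zero)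
    show "inv\<^bsub>add_monoid A\<^esub> x \<in> W" if "x \<in> W" for x
    proof -
      obtain p where "x = \<pi> p" using sub \<open>x \<in> W\<close> by auto
      then show ?thesis using that subspace_neg[OF ss, of p] by (auto simp: inv_add)
    qed
    show "x \<otimes>\<^bsub>add_monoid A\<^esub> y \<in> W" if xy: "x \<in> W" "y \<in> W" for x y
    proof -
      obtain p q where "x = \<pi> p" "y = \<pi> q" using sub xy by blast
      then show ?thesis using xy subspace_add[OF ss, of p q] by (auto simp: \<pi>_add)
    qed
  qed
  moreover have "c \<odot>\<^bsub>A\<^esub> x \<in> W" if x: "x \<in> W" for c x
  proof -
    obtain p where "x = \<pi> p" using sub x by blast
    then show ?thesis using x subspace_scale[OF ss, of p c] by (auto simp: \<pi>_scale)
  qed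
  ultimately show "assoc_subspace A W" by (simp add: assoc_subspace_def)
qed

lemma assoc_subalgebra_iff:
  "assoc_subalgebra A W \<longleftrightarrow> W \<subseteq> range \<pi> \<and> subspace (\<pi> -` W) \<and> \<pi> 1 \<in> W \<and>
     (\<forall>x y. \<pi> x \<in> W \<longrightarrow> \<pi> y \<in> W \<longrightarrow> \<pi> (x * y) \<in> W)"
  by (auto simp: assoc_subalgebra_def assoc_subspace_iff submonoid_def carrier_eq \<pi>_one \<pi>_mult)
    blast

lemma assoc_subspace_image:
  assumes "subspace S"
  shows "assoc_subspace A (\<pi> ` S)"
proof -
  have "subspace (\<pi> -` \<pi> ` S)"
  proof (rule subspaceI)
    show "0 \<in> \<pi> -` \<pi> ` S" using subspace_0[OF assms] by blast
    fix x y assume "x \<in> \<pi> -` \<pi> ` S" "y \<in> \<pi> -` \<pi> ` S"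
    then obtain p q where pq: "p \<in> S" "q \<in> S" "\<pi> x = \<pi> p" "\<pi> y = \<pi> q" by auto
    then have "\<pi> (x + y) = \<pi> (p + q)" by (simp add: \<pi>_add)
    then show "x + y \<in> \<pi> -` \<pi> ` S" using subspace_add[OF assms pq(1,2)] by auto
    fix c
    have "\<pi> (sc c x) = \<pi> (sc c p)" by (simp add: \<pi>_scale pq)
    then show "sc c x \<in> \<pi> -` \<pi> ` S" using subspace_scale[OF assms pq(1)] by auto
  qed
  then show ?thesis by (auto simp: assoc_subspace_iff)
qed

lemma assoc_subspace_hull: "assoc_subspace A hull (\<pi> ` S) = \<pi> ` span S"
proof (rule hull_unique)
  show "\<pi> ` S \<subseteq> \<pi> ` span S" by (intro image_mono span_superset)
  show "assoc_subspace A (\<pi> ` span S)" by (simp add: assoc_subspace_image)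
  fix W assume "\<pi> ` S \<subseteq> W" "assoc_subspace A W"
  then have "span S \<subseteq> \<pi> -` W" by (intro span_minimal) (auto simp: assoc_subspace_iff)
  then show "\<pi> ` span S \<subseteq> W" by auto
qed

text \<open>The degree filtration upstairs; its image under \<^term>\<open>\<pi>\<close> is the degree filtration of the
  quotient.\<close>

definition word_filt :: "'r set \<Rightarrow> nat \<Rightarrow> 'r set" where
  "word_filt X n = span {prod_list xs | xs. set xs \<subseteq> X \<and> length xs \<le> n}"

lemma \<pi>_prod_list: "\<pi> (prod_list xs) = foldr (monoid.mult A) (map \<pi> xs) \<one>\<^bsub>A\<^esub>"
  by (induction xs) (simp_all add: \<pi>_one \<pi>_mult)

lemma assoc_filt_image: "assoc_filt A (\<pi> ` X) n = \<pi> ` word_filt X n"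
proof -
  have "{foldr (monoid.mult A) ys \<one>\<^bsub>A\<^esub> | ys. set ys \<subseteq> \<pi> ` X \<and> length ys \<le> n} =
    \<pi> ` {prod_list xs | xs. set xs \<subseteq> X \<and> length xs \<le> n}" (is "?L = ?R")
  proof
    show "?L \<subseteq> ?R"
    proof
      fix z assume "z \<in> ?L"
      then obtain ys where ys: "z = foldr (monoid.mult A) ys \<one>\<^bsub>A\<^esub>" "set ys \<subseteq> \<pi> ` X" "length ys \<le> n"
        by blast
      then have "ys \<in> lists (\<pi> ` X)" by auto
      then obtain xs where "ys = map \<pi> xs" "set xs \<subseteq> X"
        unfolding lists_image by auto
      then show "z \<in> ?R" using ys by (auto simp flip: \<pi>_prod_list)
    qed
    show "?R \<subseteq> ?L"
    proof
      fix z assume "z \<in> ?R"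
      then obtain xs where "z = \<pi> (prod_list xs)" "set xs \<subseteq> X" "length xs \<le> n" by blast
      then have "z = foldr (monoid.mult A) (map \<pi> xs) \<one>\<^bsub>A\<^esub> \<and> set (map \<pi> xs) \<subseteq> \<pi> ` X \<and> length (map \<pi> xs) \<le> n"
        by (auto simp: \<pi>_prod_list)
      then show "z \<in> ?L" by blast
    qed
  qed
  then show ?thesis by (simp add: assoc_filt_def word_filt_def assoc_subspace_hull)
qed

lemma word_filt_mono: "m \<le> n \<Longrightarrow> word_filt X m \<subseteq> word_filt X n"
  unfolding word_filt_def by (intro span_mono) auto

lemma subspace_word_filt: "subspace (word_filt X n)"
  by (simp add: word_filt_def)

lemma prod_list_in_word_filt: "set xs \<subseteq> X \<Longrightarrow> length xs \<le> n \<Longrightarrow> prod_list xs \<in> word_filt X n"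
  unfolding word_filt_def by (intro span_base) blast

lemma one_in_word_filt: "1 \<in> word_filt X n"
  using prod_list_in_word_filt[of "[]"] by simp

lemma span_mult_subset:
  assumes "\<And>x y. x \<in> S \<Longrightarrow> y \<in> T \<Longrightarrow> x * y \<in> W" "subspace W" "x \<in> span S" "y \<in> span T"
  shows "x * y \<in> W"
proof -
  have *: "x * y \<in> W" if "y \<in> T" for y
    using \<open>x \<in> span S\<close>
  proof (rule span_induct)
    show "subspace {x. x * y \<in> W}"
      by (rule subspaceI) (auto simp: distrib_right sc_mult_left subspace_0 subspace_add subspace_scale assms(2))
  qed (use assms(1) that in auto)
  show ?thesis
    using \<open>y \<in> span T\<close>
  proof (rule span_induct)
    show "subspace {y. x * y \<in> W}"
      by (rule subspaceI) (auto simp: distrib_left sc_mult_right subspace_0 subspace_add subspace_scale assms(2))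
  qed (use * in auto)
qed

lemma word_filt_mult:
  assumes "p \<in> word_filt X m" "q \<in> word_filt X n"
  shows "p * q \<in> word_filt X (m + n)"
proof (rule span_mult_subset[OF _ subspace_word_filt])
  show "p \<in> span {prod_list xs | xs. set xs \<subseteq> X \<and> length xs \<le> m}"
    and "q \<in> span {prod_list xs | xs. set xs \<subseteq> X \<and> length xs \<le> n}"
    using assms by (simp_all add: word_filt_def)
  fix x y
  assume "x \<in> {prod_list xs | xs. set xs \<subseteq> X \<and> length xs \<le> m}"
    "y \<in> {prod_list xs | xs. set xs \<subseteq> X \<and> length xs \<le> n}"
  then obtain us vs where "x = prod_list us" "y = prod_list vs" "set us \<subseteq> X" "set vs \<subseteq> X"
    "length us \<le> m" "length vs \<le> n" by blast
  then show "x * y \<in> word_filt X (m + n)"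
    using prod_list_in_word_filt[of "us @ vs" X "m + n"] by simp
qed

lemma assoc_filt_mono:
  assumes "X \<subseteq> carrier A" "m \<le> n"
  shows "assoc_filt A X m \<subseteq> assoc_filt A X n"
proof -
  obtain X' where "X = \<pi> ` X'" using assms(1) unfolding carrier_eq by (auto simp: subset_image_iff)
  then show ?thesis using word_filt_mono[OF assms(2)] by (auto simp: assoc_filt_image)
qed

text \<open>The union of the degree filtration is closed under all operations because its terms increase
  and multiply additively in the index.\<close>

lemma generated_subset_UN_word_filt:
  "assoc_subalgebra A hull (\<pi> ` Y) \<subseteq> (\<Union>n. \<pi> ` word_filt Y n)"
proof (rule hull_minimal)
  show "\<pi> ` Y \<subseteq> (\<Union>n. \<pi> ` word_filt Y n)"
  proof
    fix z assume "z \<in> \<pi> ` Y"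
    then obtain y where "y \<in> Y" "z = \<pi> y" by blast
    then show "z \<in> (\<Union>n. \<pi> ` word_filt Y n)"
      using prod_list_in_word_filt[of "[y]" Y 1] by auto
  qed
  show "assoc_subalgebra A (\<Union>n. \<pi> ` word_filt Y n)"
    unfolding assoc_subalgebra_iff
  proof (intro conjI allI impI)
    show "subspace (\<pi> -` (\<Union>n. \<pi> ` word_filt Y n))"
    proof (rule subspaceI)
      show "0 \<in> \<pi> -` (\<Union>n. \<pi> ` word_filt Y n)"
        using subspace_0[OF subspace_word_filt] by blast
      fix x y assume "x \<in> \<pi> -` (\<Union>n. \<pi> ` word_filt Y n)" "y \<in> \<pi> -` (\<Union>n. \<pi> ` word_filt Y n)"
      then obtain p m q n where pq: "\<pi> x = \<pi> p" "\<pi> y = \<pi> q" "p \<in> word_filt Y m" "q \<in> word_filt Y n"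
        by auto
      then have "p \<in> word_filt Y (max m n)" "q \<in> word_filt Y (max m n)"
        using word_filt_mono[of m "max m n"] word_filt_mono[of n "max m n"] by auto
      then have "p + q \<in> word_filt Y (max m n)" by (rule subspace_add[OF subspace_word_filt])
      moreover have "\<pi> (x + y) = \<pi> (p + q)" using pq by (simp add: \<pi>_add)
      ultimately show "x + y \<in> \<pi> -` (\<Union>n. \<pi> ` word_filt Y n)" by blast
      fix c
      have "\<pi> (sc c x) = \<pi> (sc c p)" using pq by (simp add: \<pi>_scale)
      then show "sc c x \<in> \<pi> -` (\<Union>n. \<pi> ` word_filt Y n)"
        using subspace_scale[OF subspace_word_filt pq(3)] by blast
    qed
    show "\<pi> 1 \<in> (\<Union>n. \<pi> ` word_filt Y n)" using one_in_word_filt by blast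
    fix x y assume "\<pi> x \<in> (\<Union>n. \<pi> ` word_filt Y n)" "\<pi> y \<in> (\<Union>n. \<pi> ` word_filt Y n)"
    then obtain p m q n where pq: "\<pi> x = \<pi> p" "\<pi> y = \<pi> q" "p \<in> word_filt Y m" "q \<in> word_filt Y n"
      by auto
    have "\<pi> (x * y) = \<pi> (p * q)" using pq by (simp add: \<pi>_mult)
    then show "\<pi> (x * y) \<in> (\<Union>n. \<pi> ` word_filt Y n)"
      using word_filt_mult[OF pq(3,4)] by blast
  qed auto
qed

text \<open>Finitely many generators have a common degree bound \<open>c\<close> with respect to the other
  generators, and degrees add up in products.\<close>

lemma assoc_filt_linear_comparison:
  assumes "finite X" "X \<subseteq> assoc_subalgebra A hull Y" "Y \<subseteq> carrier A"
  obtains c where "\<And>n. assoc_filt A X n \<subseteq> assoc_filt A Y (c * n)"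
proof -
  obtain Y' where Y: "Y = \<pi> ` Y'" using assms(3) unfolding carrier_eq by (auto simp: subset_image_iff)
  have "\<forall>x\<in>X. \<exists>p k. x = \<pi> p \<and> p \<in> word_filt Y' k"
    using assms(2) generated_subset_UN_word_filt[of Y'] by (fastforce simp: Y)
  then obtain h k where hk: "\<And>x. x \<in> X \<Longrightarrow> x = \<pi> (h x) \<and> h x \<in> word_filt Y' (k x)"
    by metis
  define c where "c = Max (insert 0 (k ` X))"
  have h: "h x \<in> word_filt Y' c" if "x \<in> X" for x
  proof -
    have "k x \<le> c" unfolding c_def using assms(1) that by (intro Max_ge) auto
    then show ?thesis using hk[OF that] word_filt_mono by blast
  qed
  have X: "X = \<pi> ` (h ` X)" using hk by (force simp: image_image)
  have "assoc_filt A X n \<subseteq> assoc_filt A Y (c * n)" for n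
  proof -
    have "prod_list xs \<in> word_filt Y' (c * n)" if "set xs \<subseteq> h ` X" "length xs \<le> n" for xs
    proof -
      have "prod_list xs \<in> word_filt Y' (c * length xs)"
        using that(1)
      proof (induction xs)
        case (Cons a xs)
        then have "a * prod_list xs \<in> word_filt Y' (c + c * length xs)"
          by (intro word_filt_mult) (use h in auto)
        then show ?case by simp
      qed (simp add: one_in_word_filt)
      moreover have "c * length xs \<le> c * n" using that by simp
      ultimately show ?thesis using word_filt_mono by blast
    qed
    then have "word_filt (h ` X) n \<subseteq> word_filt Y' (c * n)"
      unfolding word_filt_def[of "h ` X"] by (intro span_minimal subspace_word_filt) auto
    then show ?thesis by (subst X) (auto simp only: Y assoc_filt_image)
  qed
  then show ?thesis by (rule that)
qed

lemma assoc_generates_carrier: "assoc_generates A X B \<Longrightarrow> assoc_subalgebra A B \<Longrightarrow> X \<subseteq> carrier A"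
  using hull_subset[of X "assoc_subalgebra A"]
  by (auto simp: assoc_generates_def assoc_subalgebra_iff carrier_eq)

lemma assoc_subalgebra_carrier: "assoc_subalgebra A (carrier A)"
  by (auto simp: assoc_subalgebra_iff carrier_eq intro: subspaceI)

text \<open>The union that defines \<^const>\<open>assoc_dist\<close> is a single class. Finiteness of the distortion has to
  be known for one pair of generating sets only; the comparison carries it to every other pair.\<close>

lemma assoc_dist_eq_func_class:
  assumes X: "finite X" "assoc_generates A X (carrier A)"
    and Y: "finite Y" "assoc_generates A Y B" and B: "assoc_subalgebra A B"
    and dist: "\<And>n. \<exists>m. B \<inter> assoc_filt A X n \<subseteq> assoc_filt A Y m"
  shows "assoc_dist A B = func_class (distortion (assoc_filt A X) B (assoc_filt A Y))"
proof -
  have "func_class (distortion (assoc_filt A X') B (assoc_filt A Y')) =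
      func_class (distortion (assoc_filt A X) B (assoc_filt A Y))"
    if X': "finite X'" "assoc_generates A X' (carrier A)"
      and Y': "finite Y'" "assoc_generates A Y' B" for X' Y'
  proof -
    note carr = assoc_generates_carrier[OF X(2) assoc_subalgebra_carrier]
      assoc_generates_carrier[OF X'(2) assoc_subalgebra_carrier]
      assoc_generates_carrier[OF Y(2) B] assoc_generates_carrier[OF Y'(2) B]
    have sub: "X \<subseteq> carrier A" "X' \<subseteq> carrier A" "Y \<subseteq> B" "Y' \<subseteq> B"
      using carr Y(2) Y'(2) hull_subset[of Y "assoc_subalgebra A"] hull_subset[of Y' "assoc_subalgebra A"]
      by (auto simp: assoc_generates_def)
    obtain c1 where c1: "\<And>n. assoc_filt A X n \<subseteq> assoc_filt A X' (c1 * n)"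
      using assoc_filt_linear_comparison[of X X'] X X' carr sub by (auto simp: assoc_generates_def)
    obtain c2 where c2: "\<And>n. assoc_filt A X' n \<subseteq> assoc_filt A X (c2 * n)"
      using assoc_filt_linear_comparison[of X' X] X X' carr sub by (auto simp: assoc_generates_def)
    obtain c3 where c3: "\<And>n. assoc_filt A Y n \<subseteq> assoc_filt A Y' (c3 * n)"
      using assoc_filt_linear_comparison[of Y Y'] Y Y' carr sub by (auto simp: assoc_generates_def)
    obtain c4 where c4: "\<And>n. assoc_filt A Y' n \<subseteq> assoc_filt A Y (c4 * n)"
      using assoc_filt_linear_comparison[of Y' Y] Y Y' carr sub by (auto simp: assoc_generates_def)
    have "\<exists>m. B \<inter> assoc_filt A X' n \<subseteq> assoc_filt A Y' m" for n
    proof -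
      obtain m where "B \<inter> assoc_filt A X (c2 * n) \<subseteq> assoc_filt A Y m" using dist by blast
      then have "B \<inter> assoc_filt A X' n \<subseteq> assoc_filt A Y' (c3 * m)" using c2[of n] c3[of m] by blast
      then show ?thesis ..
    qed
    then have "func_equiv (distortion (assoc_filt A X') B (assoc_filt A Y'))
        (distortion (assoc_filt A X) B (assoc_filt A Y))"
      unfolding func_equiv_def
      using distortion_func_le[where A = "assoc_filt A X'" and A' = "assoc_filt A X" and B = B
          and Bf = "assoc_filt A Y'" and B' = "assoc_filt A Y", OF c2 c3 dist assoc_filt_mono[OF carr(1)]]
        distortion_func_le[where A = "assoc_filt A X" and A' = "assoc_filt A X'" and B = B
          and Bf = "assoc_filt A Y" and B' = "assoc_filt A Y'", OF c1 c4 _ assoc_filt_mono[OF carr(2)]]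
      by blast
    then show ?thesis by (rule func_class_eqI)
  qed
  then show ?thesis unfolding assoc_dist_def using X Y by blast
qed

end

section \<open>The free algebra as a vector space\<close>

lemma fscale_eq_mult: "fscale c p = Poly_Mapping.single 0 c * p"
  by (simp add: fscale_def mult_map_scale_conv_mult)

lemma lookup_fscale [simp]: "Poly_Mapping.lookup (fscale c p) w = c * Poly_Mapping.lookup p w"
  unfolding fscale_def by transfer (auto simp: when_def)

interpretation free: vector_space "fscale :: 'f::field \<Rightarrow> ('a free_word \<Rightarrow>\<^sub>0 'f) \<Rightarrow> _"
  by standard (auto intro!: poly_mapping_eqI simp: lookup_add algebra_simps)

definition monomial :: "'a list \<Rightarrow> ('a free_word \<Rightarrow>\<^sub>0 'f::field)" where
  "monomial w = Poly_Mapping.single (Word w) 1"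

lemma monomial_append: "monomial (u @ v) = monomial u * monomial v"
  by (simp add: monomial_def mult_single plus_free_word_def)

lemma monomial_Nil: "monomial [] = 1"
  by (simp add: monomial_def flip: zero_free_word_def)

lemma gen_eq_monomial: "gen x = monomial [x]"
  by (simp add: gen_def monomial_def)

lemma monomial_Cons: "monomial (x # w) = gen x * monomial w"
  using monomial_append[of "[x]" w] by (simp add: gen_eq_monomial)

lemma monomial_eq_prod_list: "monomial w = prod_list (map gen w)"
  by (induction w) (simp_all add: monomial_Nil monomial_Cons)

lemma keys_monomial [simp]: "Poly_Mapping.keys (monomial w :: _ \<Rightarrow>\<^sub>0 'f::field) = {Word w}"
  by (simp add: monomial_def)

lemma fscale_mult_left: "fscale c p * q = fscale c (p * q)"
  by (simp add: fscale_eq_mult mult.assoc)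

text \<open>Together with \<open>in_free_subspaceI\<close> below, this reduces linear statements about the free algebra to words.\<close>

lemma free_algebra_expansion:
  "p = (\<Sum>w\<in>Poly_Mapping.keys p. fscale (Poly_Mapping.lookup p w) (monomial (letters w)))"
proof -
  have "Poly_Mapping.lookup (\<Sum>w\<in>Poly_Mapping.keys p. fscale (Poly_Mapping.lookup p w) (monomial (letters w))) k
      = (\<Sum>w\<in>Poly_Mapping.keys p. if w = k then Poly_Mapping.lookup p k else 0)" for k
    unfolding lookup_sum by (rule sum.cong) (auto simp: monomial_def lookup_single when_def)
  then show ?thesis
    by (intro poly_mapping_eqI) (simp add: in_keys_iff)
qed

lemma fscale_mult_right: "p * fscale c q = fscale c (p * q)"
proof -
  have "p * Poly_Mapping.single 0 c = Poly_Mapping.single 0 c * p"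
  proof -
    have *: "fscale a (monomial w) = Poly_Mapping.single (Word w) a" for a :: 'b and w :: "'a list"
      by (simp add: fscale_eq_mult monomial_def mult_single)
    have "(\<Sum>w\<in>Poly_Mapping.keys p. fscale (Poly_Mapping.lookup p w) (monomial (letters w))) * Poly_Mapping.single 0 c
      = Poly_Mapping.single 0 c * (\<Sum>w\<in>Poly_Mapping.keys p. fscale (Poly_Mapping.lookup p w) (monomial (letters w)))"
      by (simp add: * sum_distrib_left sum_distrib_right mult_single mult.commute)
    then show ?thesis by (simp flip: free_algebra_expansion)
  qed
  then show ?thesis by (simp add: fscale_eq_mult flip: mult.assoc)
qed

lemma in_free_subspaceI:
  assumes "free.subspace W" "\<And>w. Word w \<in> Poly_Mapping.keys p \<Longrightarrow> monomial w \<in> W"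
  shows "p \<in> W"
proof -
  have "monomial (letters w) \<in> W" if "w \<in> Poly_Mapping.keys p" for w
    using that assms(2)[of "letters w"] by (cases w) auto
  then have "(\<Sum>w\<in>Poly_Mapping.keys p. fscale (Poly_Mapping.lookup p w) (monomial (letters w))) \<in> W"
    by (intro free.subspace_sum free.subspace_scale assms(1)) auto
  then show ?thesis using free_algebra_expansion[of p] by simp
qed

text \<open>Normal forms are compared by the words that occur in them: with weights bounded by \<open>n\<close>, or
  with letters in a subalgebra.\<close>

definition supported_on :: "('a list \<Rightarrow> bool) \<Rightarrow> ('a free_word \<Rightarrow>\<^sub>0 'f::field) set" where
  "supported_on Q = {p. \<forall>w. Word w \<in> Poly_Mapping.keys p \<longrightarrow> Q w}"

lemma supported_onD: "p \<in> supported_on Q \<Longrightarrow> Word w \<in> Poly_Mapping.keys p \<Longrightarrow> Q w"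
  by (simp add: supported_on_def)

lemma monomial_supported_on [simp]: "monomial w \<in> (supported_on Q :: (_ \<Rightarrow>\<^sub>0 'f::field) set) \<longleftrightarrow> Q w"
  by (simp add: supported_on_def)

lemma subspace_supported_on:
  "free.subspace (supported_on Q :: ('a free_word \<Rightarrow>\<^sub>0 'f::field) set)"
proof (rule free.subspaceI)
  fix p q :: "'a free_word \<Rightarrow>\<^sub>0 'f" and c
  assume "p \<in> supported_on Q" "q \<in> supported_on Q"
  then show "p + q \<in> supported_on Q" "fscale c p \<in> supported_on Q"
    using keys_add[of p q] by (auto simp: supported_on_def in_keys_iff)
qed (simp add: supported_on_def)

lemma supported_on_True [simp]: "supported_on (\<lambda>w. True) = UNIV"
  by (simp add: supported_on_def)

lemma supported_on_mono: "(\<And>w. Q w \<Longrightarrow> R w) \<Longrightarrow> supported_on Q \<subseteq> supported_on R"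
  by (auto simp: supported_on_def)

lemma supported_on_mult:
  assumes "p \<in> supported_on Q" "q \<in> supported_on R" "\<And>u v. Q u \<Longrightarrow> R v \<Longrightarrow> S (u @ v)"
  shows "p * q \<in> supported_on S"
  unfolding supported_on_def mem_Collect_eq
proof (intro allI impI)
  fix w assume "Word w \<in> Poly_Mapping.keys (p * q)"
  then obtain a b where ab: "Word w = a + b" "a \<in> Poly_Mapping.keys p" "b \<in> Poly_Mapping.keys q"
    using keys_mult[of p q] by blast
  then show "S w" using assms by (cases a; cases b) (auto simp: supported_on_def plus_free_word_def)
qed

definition linear_extension :: "('a list \<Rightarrow> ('b free_word \<Rightarrow>\<^sub>0 'f)) \<Rightarrow> ('a free_word \<Rightarrow>\<^sub>0 'f::field) \<Rightarrow> ('b free_word \<Rightarrow>\<^sub>0 'f)" where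
  "linear_extension f p = (\<Sum>w\<in>Poly_Mapping.keys p. fscale (Poly_Mapping.lookup p w) (f (letters w)))"

lemma linear_extension_superset:
  assumes "finite S" "Poly_Mapping.keys p \<subseteq> S"
  shows "linear_extension f p = (\<Sum>w\<in>S. fscale (Poly_Mapping.lookup p w) (f (letters w)))"
  unfolding linear_extension_def using assms by (intro sum.mono_neutral_left) (auto simp: in_keys_iff)

lemma linear_extension_add: "linear_extension f (p + q) = linear_extension f p + linear_extension f q"
proof -
  let ?S = "Poly_Mapping.keys p \<union> Poly_Mapping.keys q"
  have "linear_extension f (p + q) = (\<Sum>w\<in>?S. fscale (Poly_Mapping.lookup (p + q) w) (f (letters w)))"
    by (rule linear_extension_superset) (use keys_add[of p q] in auto)
  moreover have "linear_extension f p = (\<Sum>w\<in>?S. fscale (Poly_Mapping.lookup p w) (f (letters w)))"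
    "linear_extension f q = (\<Sum>w\<in>?S. fscale (Poly_Mapping.lookup q w) (f (letters w)))"
    by (rule linear_extension_superset; auto)+
  ultimately show ?thesis by (simp add: lookup_add free.scale_left_distrib sum.distrib)
qed

lemma linear_extension_zero [simp]: "linear_extension f 0 = 0"
  by (simp add: linear_extension_def)

lemma linear_extension_fscale: "linear_extension f (fscale c p) = fscale c (linear_extension f p)"
proof -
  have "linear_extension f (fscale c p) = (\<Sum>w\<in>Poly_Mapping.keys p. fscale (Poly_Mapping.lookup (fscale c p) w) (f (letters w)))"
    by (rule linear_extension_superset) (auto simp: in_keys_iff)
  then show ?thesis by (simp add: linear_extension_def free.scale_sum_right)
qed

lemma linear_extension_uminus: "linear_extension f (- p) = - linear_extension f p"
  using linear_extension_add[of f p "- p"] by (simp add: add_eq_0_iff)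

lemma linear_extension_diff: "linear_extension f (p - q) = linear_extension f p - linear_extension f q"
  using linear_extension_add[of f p "- q"] by (simp add: linear_extension_uminus)

lemma linear_extension_sum: "linear_extension f (sum g S) = (\<Sum>x\<in>S. linear_extension f (g x))"
  by (induction S rule: infinite_finite_induct) (simp_all add: linear_extension_add)

lemma linear_extension_monomial [simp]: "linear_extension f (monomial w) = f w"
  unfolding linear_extension_def by (simp add: monomial_def)

lemma linear_extension_in_subspace:
  assumes "free.subspace W" "\<And>w. Word w \<in> Poly_Mapping.keys p \<Longrightarrow> f w \<in> W"
  shows "linear_extension f p \<in> W"
proof -
  have "f (letters w) \<in> W" if "w \<in> Poly_Mapping.keys p" for w
    using that assms(2)[of "letters w"] by (cases w) auto
  then show ?thesis unfolding linear_extension_def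
    by (intro free.subspace_sum free.subspace_scale assms(1)) auto
qed

subsection \<open>The free algebra as a ring with carrier\<close>

lemma free_algebra_simps [simp]:
  "monoid.mult (free_algebra S) = (*)" "one (free_algebra S) = 1" "zero (free_algebra S) = 0"
  "add (free_algebra S) = (+)" "smult (free_algebra S) = fscale"
  "carrier (free_algebra S) = supported_on (\<lambda>w. set w \<subseteq> S)"
proof -
  show "carrier (free_algebra S) = supported_on (\<lambda>w. set w \<subseteq> S)"
    unfolding free_algebra_def supported_on_def
    by auto (metis free_word.sel free_word.collapse subset_eq)+
qed (simp_all add: free_algebra_def)

lemma ring_free_algebra: "ring (free_algebra S)"
proof (rule ringI)
  note sub = subspace_supported_on[of "\<lambda>w. set w \<subseteq> S"]
  show "abelian_group (free_algebra S)"
  proof (rule abelian_groupI)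
    fix x assume x: "x \<in> carrier (free_algebra S)"
    then have "- x \<in> carrier (free_algebra S)" using free.subspace_neg[OF sub] by simp
    then show "\<exists>y\<in>carrier (free_algebra S). y \<oplus>\<^bsub>free_algebra S\<^esub> x = \<zero>\<^bsub>free_algebra S\<^esub>"
      by (intro bexI[of _ "- x"]) auto
  qed (auto simp: free.subspace_add[OF sub] free.subspace_0[OF sub] ac_simps)
  show "monoid (free_algebra S)"
  proof (rule monoidI)
    show "\<one>\<^bsub>free_algebra S\<^esub> \<in> carrier (free_algebra S)"
      by (simp flip: monomial_Nil)
    show "x \<otimes>\<^bsub>free_algebra S\<^esub> y \<in> carrier (free_algebra S)"
      if "x \<in> carrier (free_algebra S)" "y \<in> carrier (free_algebra S)" for x y
      using that by (auto elim!: supported_on_mult)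
  qed (auto simp: mult.assoc)
qed (auto simp: distrib_left distrib_right)

lemma a_inv_free_algebra:
  assumes "p \<in> carrier (free_algebra S)"
  shows "\<ominus>\<^bsub>free_algebra S\<^esub> p = - p"
proof -
  interpret ring "free_algebra S" by (rule ring_free_algebra)
  have "- p \<in> carrier (free_algebra S)"
    using assms free.subspace_neg[OF subspace_supported_on] by simp
  then show ?thesis by (intro minus_equality) (use assms in auto)
qed

lemma ideal_free_algebraI:
  assumes "free.subspace K" "K \<subseteq> carrier (free_algebra S)"
    and "\<And>p q. p \<in> K \<Longrightarrow> q \<in> carrier (free_algebra S) \<Longrightarrow> q * p \<in> K \<and> p * q \<in> K"
  shows "ideal K (free_algebra S)"
proof (rule idealI[OF ring_free_algebra])
  interpret ring "free_algebra S" by (rule ring_free_algebra)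
  show "subgroup K (add_monoid (free_algebra S))"
  proof (rule group.subgroupI[OF add.is_group])
    fix a assume "a \<in> K"
    then have "\<ominus>\<^bsub>free_algebra S\<^esub> a = - a" using assms(2) a_inv_free_algebra by blast
    then show "inv\<^bsub>add_monoid (free_algebra S)\<^esub> a \<in> K"
      using free.subspace_neg[OF assms(1) \<open>a \<in> K\<close>] by (simp add: a_inv_def)
  qed (use assms free.subspace_0[OF assms(1)] in \<open>auto intro: free.subspace_add\<close>)
qed (use assms(3) in auto)

lemma ideal_free_algebra_subspace:
  assumes "ideal K (free_algebra S :: ('f::field, _) module)"
  shows "free.subspace K"
proof -
  interpret ideal K "free_algebra S" by fact
  show ?thesis
  proof (rule free.subspaceI)
    show "0 \<in> K" using additive_subgroup.zero_closed[OF ideal.axioms(1)[OF assms]] by simp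
    fix x y assume "x \<in> K" "y \<in> K"
    then show "x + y \<in> K" using additive_subgroup.a_closed[OF ideal.axioms(1)[OF assms]] by simp
    fix c :: 'f
    have "Poly_Mapping.single 0 c \<in> carrier (free_algebra S)"
      by (auto simp: supported_on_def zero_free_word_def split: if_splits)
    then show "fscale c x \<in> K" using I_l_closed[OF \<open>x \<in> K\<close>] by (simp add: fscale_eq_mult)
  qed
qed

section \<open>The defining ideal of the enveloping algebra\<close>

context lie_algebra
begin

lemma uea_relations_subset:
  assumes "lie_subalgebra S"
  shows "uea_relations S \<subseteq> carrier (free_algebra S)"
proof -
  have closed: "x + y \<in> S" "scale c x \<in> S" "bracket x y \<in> S" if "x \<in> S" "y \<in> S" for x y c
    using assms that by (auto simp: lie_subalgebra_def subspace_add subspace_scale)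
  note sub = subspace_supported_on[of "\<lambda>w. set w \<subseteq> S"]
  have gen: "gen x \<in> supported_on (\<lambda>w. set w \<subseteq> S)" if "x \<in> S" for x
    using that by (simp add: gen_eq_monomial)
  have "gen x * gen y \<in> supported_on (\<lambda>w. set w \<subseteq> S)" if "x \<in> S" "y \<in> S" for x y
    using that by (auto intro!: supported_on_mult[OF gen gen])
  then show ?thesis
    unfolding uea_relations_def
    by (auto intro!: free.subspace_diff[OF sub] free.subspace_add[OF sub] free.subspace_scale[OF sub] gen closed)
qed

lemma lie_subalgebra_UNIV: "lie_subalgebra UNIV"
  by (simp add: lie_subalgebra_def subspace_def)

lemma ideal_uea_ideal:
  assumes "lie_subalgebra S"
  shows "ideal (uea_ideal S) (free_algebra S)"
  unfolding uea_ideal_def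
  by (intro ring.genideal_ideal ring_free_algebra uea_relations_subset assms)

lemma uea_relations_in_ideal:
  assumes "lie_subalgebra S"
  shows "uea_relations S \<subseteq> uea_ideal S"
  unfolding uea_ideal_def
  by (intro ring.genideal_self ring_free_algebra uea_relations_subset assms)

lemma uea_ideal_minimal:
  assumes "ideal K (free_algebra S)" "uea_relations S \<subseteq> K"
  shows "uea_ideal S \<subseteq> K"
  unfolding uea_ideal_def by (intro ring.genideal_minimal ring_free_algebra assms)

lemma subspace_uea_ideal: "free.subspace (uea_ideal UNIV)"
  by (rule ideal_free_algebra_subspace[OF ideal_uea_ideal[OF lie_subalgebra_UNIV]])

lemma uea_ideal_mult:
  assumes "p \<in> uea_ideal UNIV"
  shows "q * p \<in> uea_ideal UNIV" "p * q \<in> uea_ideal UNIV"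
  using ideal.I_l_closed[OF ideal_uea_ideal[OF lie_subalgebra_UNIV] assms, of q]
    ideal.I_r_closed[OF ideal_uea_ideal[OF lie_subalgebra_UNIV] assms, of q] by simp_all

lemma gen_add_relation: "gen (x + y) - (gen x + gen y) \<in> uea_ideal UNIV"
  by (rule subsetD[OF uea_relations_in_ideal[OF lie_subalgebra_UNIV]], unfold uea_relations_def, rule UnI1, rule UnI1) blast

lemma gen_scale_relation: "gen (scale c x) - fscale c (gen x) \<in> uea_ideal UNIV"
  by (rule subsetD[OF uea_relations_in_ideal[OF lie_subalgebra_UNIV]], unfold uea_relations_def, rule UnI1, rule UnI2) blast

lemma gen_bracket_relation:
  "gen x * gen y - gen y * gen x - gen (bracket x y) \<in> uea_ideal UNIV"
  by (rule subsetD[OF uea_relations_in_ideal[OF lie_subalgebra_UNIV]], unfold uea_relations_def, rule UnI2) blast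

lemma bracket_swap: "bracket x y = - bracket y x"
proof -
  have "bracket x y + bracket y x = 0"
  proof -
    have "0 = bracket (x + y) (x + y)" by (simp only: bracket_self)
    also have "\<dots> = (bracket x x + bracket y x) + (bracket x y + bracket y y)"
      by (simp only: bracket_add_left bracket_add_right)
    finally show ?thesis by (simp add: bracket_self add.commute)
  qed
  then show ?thesis by (simp add: eq_neg_iff_add_eq_0)
qed

lemma bracket_neg: "bracket x (- y) = - bracket x y" "bracket (- x) y = - bracket x y"
  using bracket_scale_right[of x "- 1" y] bracket_scale_left[of "- 1" x y] by simp_all

text \<open>The form in which the Jacobi identity appears when a word with two overlapping descents
  \<open>c b a\<close> is straightened in two ways.\<close>

lemma jacobi_reverse:
  "bracket (bracket c b) a + bracket b (bracket c a) + bracket (bracket b a) c = 0"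
  using jacobi[of a b c] bracket_swap[of "bracket c b" a] bracket_swap[of "bracket b a" c]
    bracket_swap[of c b] bracket_swap[of b a] by (simp add: bracket_neg)

end

section \<open>Weights of elements in a filtration\<close>

definition weight :: "(nat \<Rightarrow> 'a set) \<Rightarrow> 'a \<Rightarrow> nat" where
  "weight V x = (LEAST n. x \<in> V n)"

lemma weight_le: "x \<in> V n \<Longrightarrow> weight V x \<le> n"
  unfolding weight_def by (rule Least_le)

lemma weight_mem: "x \<in> (\<Union>k. V k) \<Longrightarrow> x \<in> V (weight V x)"
  unfolding weight_def by (auto intro: LeastI)

section \<open>The Poincare-Birkhoff-Witt projection\<close>

locale ordered_lie_basis = lie_algebra scale bracket
  for scale :: "'f::field \<Rightarrow> 'l::ab_group_add \<Rightarrow> 'l" and bracket :: "'l \<Rightarrow> 'l \<Rightarrow> 'l" +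
  fixes B :: "'l set" and lt :: "'l \<Rightarrow> 'l \<Rightarrow> bool"  (infix \<open>\<prec>\<close> 50)
  assumes independent_B: "independent B" and span_B: "span B = UNIV"
    and lt_irrefl: "\<not> a \<prec> a" and lt_trans: "a \<prec> b \<Longrightarrow> b \<prec> c \<Longrightarrow> a \<prec> c"
    and lt_total: "a \<prec> b \<or> a = b \<or> b \<prec> a"
begin

abbreviation coord :: "'l \<Rightarrow> 'l \<Rightarrow> 'f" where
  "coord \<equiv> representation B"

text \<open>The linear form of an element of \<open>L\<close> in the letters from \<open>B\<close>. Being linear in \<open>x\<close>, it absorbs
  the linear relations of the enveloping algebra; only the commutator relations are left for straightening.\<close>

definition expand :: "'l \<Rightarrow> ('l free_word \<Rightarrow>\<^sub>0 'f)" where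
  "expand x = (\<Sum>e | coord x e \<noteq> 0. fscale (coord x e) (gen e))"

lemma expand_superset:
  assumes "finite T" "{e. coord x e \<noteq> 0} \<subseteq> T"
  shows "expand x = (\<Sum>e\<in>T. fscale (coord x e) (gen e))"
  unfolding expand_def using assms by (intro sum.mono_neutral_left) auto

lemma expand_add: "expand (x + y) = expand x + expand y"
proof -
  let ?T = "{e. coord x e \<noteq> 0} \<union> {e. coord y e \<noteq> 0}"
  have c: "coord (x + y) = (\<lambda>e. coord x e + coord y e)"
    by (intro ext representation_add) (simp_all add: independent_B span_B)
  have "expand (x + y) = (\<Sum>e\<in>?T. fscale (coord (x + y) e) (gen e))"
    by (rule expand_superset) (auto simp: finite_representation c)
  moreover have "expand x = (\<Sum>e\<in>?T. fscale (coord x e) (gen e))"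
    "expand y = (\<Sum>e\<in>?T. fscale (coord y e) (gen e))"
    by (rule expand_superset; auto simp: finite_representation)+
  ultimately show ?thesis by (simp add: c free.scale_left_distrib sum.distrib)
qed

lemma expand_scale: "expand (scale c x) = fscale c (expand x)"
proof -
  have c: "coord (scale c x) = (\<lambda>e. c * coord x e)"
    by (intro ext representation_scale) (simp_all add: independent_B span_B)
  have "expand (scale c x) = (\<Sum>e | coord x e \<noteq> 0. fscale (coord (scale c x) e) (gen e))"
    by (rule expand_superset) (auto simp: finite_representation c)
  then show ?thesis by (simp add: c expand_def free.scale_sum_right)
qed

lemma expand_zero: "expand 0 = 0"
  using expand_scale[of 0 0] by simp

lemma expand_uminus: "expand (- x) = - expand x"
  using expand_scale[of "- 1" x] by simp

lemma expand_basis: "e \<in> B \<Longrightarrow> expand e = gen e"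
  unfolding expand_def by (simp add: representation_basis independent_B)

lemma subspace_expand_vimage: "free.subspace W \<Longrightarrow> subspace {x. expand x \<in> W}"
  by (rule subspaceI) (auto simp: expand_add expand_scale expand_zero free.subspace_0 free.subspace_add free.subspace_scale)

lemma expand_supported_on:
  assumes "x \<in> span C" "C \<subseteq> B"
  shows "expand x \<in> supported_on (\<lambda>w. \<exists>e\<in>C. w = [e])"
  using assms(1)
proof (rule span_induct)
  show "subspace {x. expand x \<in> supported_on (\<lambda>w. \<exists>e\<in>C. w = [e])}"
    by (rule subspace_expand_vimage[OF subspace_supported_on])
qed (use assms(2) in \<open>auto simp: expand_basis gen_eq_monomial\<close>)

lemma expand_supported_on_basis: "expand x \<in> supported_on (\<lambda>w. set w \<subseteq> B \<and> length w \<le> 1)"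
  by (rule subsetD[OF supported_on_mono expand_supported_on[of x B]]) (auto simp: span_B)

text \<open>The linear relations alone identify a generator with its expansion in the basis.\<close>

lemma expand_eq_gen: "expand x - gen x \<in> uea_ideal UNIV"
proof -
  have "x \<in> span B" by (simp add: span_B)
  then show ?thesis
  proof (rule span_induct)
    show "subspace {x. expand x - gen x \<in> uea_ideal UNIV}"
    proof (rule subspaceI)
      have "gen (scale 0 0) - fscale 0 (gen 0) \<in> uea_ideal UNIV" by (rule gen_scale_relation)
      then show "0 \<in> {x. expand x - gen x \<in> uea_ideal UNIV}"
        using free.subspace_neg[OF subspace_uea_ideal] by (fastforce simp: expand_zero)
      fix x y assume xy: "x \<in> {x. expand x - gen x \<in> uea_ideal UNIV}" "y \<in> {x. expand x - gen x \<in> uea_ideal UNIV}"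
      have "(expand x - gen x) + (expand y - gen y) - (gen (x + y) - (gen x + gen y)) \<in> uea_ideal UNIV"
        using xy by (intro free.subspace_diff[OF subspace_uea_ideal free.subspace_add[OF subspace_uea_ideal]]
            gen_add_relation) auto
      moreover have "(expand x - gen x) + (expand y - gen y) - (gen (x + y) - (gen x + gen y)) =
          expand (x + y) - gen (x + y)"
        by (simp add: expand_add)
      ultimately show "x + y \<in> {x. expand x - gen x \<in> uea_ideal UNIV}" by simp
      fix c
      have "fscale c (expand x - gen x) - (gen (scale c x) - fscale c (gen x)) \<in> uea_ideal UNIV"
        using xy by (intro free.subspace_diff[OF subspace_uea_ideal free.subspace_scale[OF subspace_uea_ideal]]
            gen_scale_relation) auto
      then show "scale c x \<in> {x. expand x - gen x \<in> uea_ideal UNIV}"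
        by (simp add: expand_scale free.scale_right_diff_distrib)
    qed
  qed (use free.subspace_0[OF subspace_uea_ideal] in \<open>auto simp: expand_basis\<close>)
qed

subsection \<open>Straightening words in the basis\<close>

fun inversions :: "'l list \<Rightarrow> nat" where
  "inversions [] = 0"
| "inversions (x # xs) = length (filter (\<lambda>y. y \<prec> x) xs) + inversions xs"

text \<open>Together with the length of the word, this is the termination order of straightening: a
  swap lowers the number of inversions, a bracket lowers the length.\<close>

lemma inversions_swap: "a \<prec> b \<Longrightarrow> inversions (u @ a # b # v) < inversions (u @ b # a # v)"
proof (induction u)
  case Nil
  then have "\<not> b \<prec> a" using lt_irrefl lt_trans by blast
  with Nil show ?case by simp
qed simp

definition has_descent :: "'l list \<Rightarrow> bool" where
  "has_descent w \<longleftrightarrow> (\<exists>u b a v. w = u @ b # a # v \<and> a \<prec> b)"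

definition some_descent :: "'l list \<Rightarrow> 'l list \<times> 'l \<times> 'l \<times> 'l list" where
  "some_descent w = (SOME (u, b, a, v). w = u @ b # a # v \<and> a \<prec> b)"

lemma some_descent:
  assumes "has_descent w" "some_descent w = (u, b, a, v)"
  shows "w = u @ b # a # v \<and> a \<prec> b"
proof -
  have "\<exists>x. case x of (u, b, a, v) \<Rightarrow> w = u @ b # a # v \<and> a \<prec> b"
    using assms(1) by (auto simp: has_descent_def)
  from someI_ex[OF this] show ?thesis
    using assms(2) by (simp add: some_descent_def)
qed

text \<open>The descent that is resolved first is arbitrary; \<open>resolvable_basis_word\<close> shows that any other
  choice leads to the same result. A word with no descent is a normal form.\<close>

function straighten :: "'l list \<Rightarrow> ('l free_word \<Rightarrow>\<^sub>0 'f)" where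
  "straighten w =
     (if has_descent w then
        (case some_descent w of (u, b, a, v) \<Rightarrow>
           straighten (u @ a # b # v) +
           (\<Sum>e | coord (bracket b a) e \<noteq> 0. fscale (coord (bracket b a) e) (straighten (u @ e # v))))
      else monomial w)"
  by pat_completeness auto
termination
proof (relation "measures [length, inversions]")
  fix w u b a v q r
  assume "has_descent w" "(u, q) = some_descent w" "(b, r) = q" "(a, v) = r"
  then have "w = u @ b # a # v \<and> a \<prec> b" using some_descent by metis
  then show "(u @ a # b # v, w) \<in> measures [length, inversions]"
    using inversions_swap by auto
next
  fix w u b a v q r e
  assume "has_descent w" "(u, q) = some_descent w" "(b, r) = q" "(a, v) = r"
  then have "w = u @ b # a # v \<and> a \<prec> b" using some_descent by metis
  then show "(u @ e # v, w) \<in> measures [length, inversions]" by auto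
qed simp

declare straighten.simps [simp del]

abbreviation straight :: "('l free_word \<Rightarrow>\<^sub>0 'f) \<Rightarrow> ('l free_word \<Rightarrow>\<^sub>0 'f)" where
  "straight \<equiv> linear_extension straighten"

lemma straight_expand:
  "straight (monomial u * expand x * monomial v) = (\<Sum>e | coord x e \<noteq> 0. fscale (coord x e) (straighten (u @ e # v)))"
proof -
  have "monomial u * expand x * monomial v = (\<Sum>e | coord x e \<noteq> 0. fscale (coord x e) (monomial (u @ e # v)))"
    unfolding expand_def
    by (simp add: sum_distrib_left sum_distrib_right fscale_mult_left fscale_mult_right monomial_append monomial_Cons mult.assoc)
  then show ?thesis by (simp add: linear_extension_sum linear_extension_fscale)
qed

text \<open>The value that straightening has to take if the displayed descent \<open>b a\<close> is resolved first.\<close>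

definition resolution :: "'l list \<Rightarrow> 'l \<Rightarrow> 'l \<Rightarrow> 'l list \<Rightarrow> ('l free_word \<Rightarrow>\<^sub>0 'f)" where
  "resolution u b a v = straighten (u @ a # b # v) + straight (monomial u * expand (bracket b a) * monomial v)"

definition resolvable :: "'l list \<Rightarrow> bool" where
  "resolvable w \<longleftrightarrow> (\<forall>u b a v. w = u @ b # a # v \<longrightarrow> a \<prec> b \<longrightarrow> straighten w = resolution u b a v)"

lemma straighten_some_descent:
  assumes "has_descent w"
  obtains u b a v where "w = u @ b # a # v" "a \<prec> b" "straighten w = resolution u b a v"
proof -
  obtain u b a v where d: "some_descent w = (u, b, a, v)" by (metis prod_cases4)
  then have "straighten w = resolution u b a v"
    using assms by (subst straighten.simps) (simp add: resolution_def straight_expand)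
  then show ?thesis using some_descent[OF assms d] that by blast
qed

lemma straighten_no_descent: "\<not> has_descent w \<Longrightarrow> straighten w = monomial w"
  by (subst straighten.simps) simp

text \<open>The commutator relation after expansion in the basis; straightening must kill it in every
  context.\<close>

definition comm_defect :: "'l \<Rightarrow> 'l \<Rightarrow> ('l free_word \<Rightarrow>\<^sub>0 'f)" where
  "comm_defect x y = expand x * expand y - expand y * expand x - expand (bracket x y)"

abbreviation basis_words :: "nat \<Rightarrow> ('l free_word \<Rightarrow>\<^sub>0 'f) set" where
  "basis_words n \<equiv> supported_on (\<lambda>w. set w \<subseteq> B \<and> length w \<le> n)"

lemma basis_words_mult: "p \<in> basis_words i \<Longrightarrow> q \<in> basis_words j \<Longrightarrow> p * q \<in> basis_words (i + j)"
  by (erule (1) supported_on_mult) auto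

lemma subspace_straight_kernel: "free.subspace {p. straight (u * p * v) = 0}"
  by (rule free.subspaceI)
    (auto simp: distrib_left distrib_right fscale_mult_left fscale_mult_right linear_extension_add linear_extension_fscale)

text \<open>For basis letters this is the rewriting rule itself, read in one direction or the other
  according to the order of the two letters, and it is alternating for equal ones; the defect is bilinear in \<open>x\<close> and \<open>y\<close>.
  The bound on the length makes the lemma usable inside the induction that proves resolvability.\<close>

lemma straight_comm_defect_words:
  assumes res: "\<And>w. length w < n \<Longrightarrow> set w \<subseteq> B \<Longrightarrow> resolvable w"
    and uv: "set u \<subseteq> B" "set v \<subseteq> B" "length u + length v + 2 < n"
  shows "straight (monomial u * comm_defect x y * monomial v) = 0"
proof -
  have less: "straight (monomial u * comm_defect b a * monomial v) = 0"
    if "a \<in> B" "b \<in> B" "a \<prec> b" for a b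
  proof -
    have "resolvable (u @ b # a # v)" by (rule res) (use that uv in auto)
    then have "straighten (u @ b # a # v) = resolution u b a v"
      using that by (simp add: resolvable_def)
    moreover have "monomial u * (gen b * gen a) * monomial v = (monomial (u @ b # a # v) :: _ \<Rightarrow>\<^sub>0 'f)"
      "monomial u * (gen a * gen b) * monomial v = (monomial (u @ a # b # v) :: _ \<Rightarrow>\<^sub>0 'f)"
      by (simp_all add: monomial_append monomial_Cons mult.assoc)
    ultimately show ?thesis
      using that by (simp add: comm_defect_def expand_basis right_diff_distrib left_diff_distrib
          linear_extension_diff resolution_def)
  qed
  have swap: "comm_defect x y = - comm_defect y x" for x y
    using bracket_swap[of x y] by (simp add: comm_defect_def expand_uminus)
  have base: "straight (monomial u * comm_defect x y * monomial v) = 0" if "x \<in> B" "y \<in> B" for x y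
  proof -
    consider "x \<prec> y" | "x = y" | "y \<prec> x" using lt_total by blast
    then show ?thesis
    proof cases
      case 1
      then show ?thesis using less[of x y] that swap[of x y] by (simp add: linear_extension_uminus)
    next
      case 2
      then show ?thesis by (simp add: comm_defect_def bracket_self expand_zero)
    qed (use less that in auto)
  qed
  have left: "straight (monomial u * comm_defect x y * monomial v) = 0" if y: "y \<in> B" for x y
  proof -
    have "x \<in> span B" by (simp add: span_B)
    then show ?thesis
    proof (rule span_induct)
      show "subspace {x. straight (monomial u * comm_defect x y * monomial v) = 0}"
      proof (rule subspaceI)
        show "0 \<in> {x. straight (monomial u * comm_defect x y * monomial v) = 0}"
          using bracket_scale_left[of 0 0 y] by (simp add: comm_defect_def expand_zero)
        fix x x' assume "x \<in> {x. straight (monomial u * comm_defect x y * monomial v) = 0}"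
          "x' \<in> {x. straight (monomial u * comm_defect x y * monomial v) = 0}"
        moreover have "comm_defect (x + x') y = comm_defect x y + comm_defect x' y"
          by (simp add: comm_defect_def expand_add bracket_add_left algebra_simps)
        ultimately show "x + x' \<in> {x. straight (monomial u * comm_defect x y * monomial v) = 0}"
          by (simp add: distrib_left distrib_right linear_extension_add)
        fix c
        have "comm_defect (scale c x) y = fscale c (comm_defect x y)"
          by (simp add: comm_defect_def expand_scale bracket_scale_left fscale_mult_left
              fscale_mult_right free.scale_right_diff_distrib)
        then show "scale c x \<in> {x. straight (monomial u * comm_defect x y * monomial v) = 0}"
          using \<open>x \<in> _\<close> by (simp add: fscale_mult_left fscale_mult_right linear_extension_fscale)
      qed
    qed (use base y in auto)
  qed
  have "y \<in> span B" by (simp add: span_B)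
  then show ?thesis
  proof (rule span_induct)
    show "subspace {y. straight (monomial u * comm_defect x y * monomial v) = 0}"
    proof (rule subspaceI)
      show "0 \<in> {y. straight (monomial u * comm_defect x y * monomial v) = 0}"
        using bracket_scale_right[of x 0 0] by (simp add: comm_defect_def expand_zero)
      fix y y' assume "y \<in> {y. straight (monomial u * comm_defect x y * monomial v) = 0}"
        "y' \<in> {y. straight (monomial u * comm_defect x y * monomial v) = 0}"
      moreover have "comm_defect x (y + y') = comm_defect x y + comm_defect x y'"
        by (simp add: comm_defect_def expand_add bracket_add_right algebra_simps)
      ultimately show "y + y' \<in> {y. straight (monomial u * comm_defect x y * monomial v) = 0}"
        by (simp add: distrib_left distrib_right linear_extension_add)
      fix c
      have "comm_defect x (scale c y) = fscale c (comm_defect x y)"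
        by (simp add: comm_defect_def expand_scale bracket_scale_right fscale_mult_left
            fscale_mult_right free.scale_right_diff_distrib)
      then show "scale c y \<in> {y. straight (monomial u * comm_defect x y * monomial v) = 0}"
        using \<open>y \<in> _\<close> by (simp add: fscale_mult_left fscale_mult_right linear_extension_fscale)
    qed
  qed (use left in auto)
qed

lemma straight_zero_bilinear:
  assumes "\<And>u v. Word u \<in> Poly_Mapping.keys p \<Longrightarrow> Word v \<in> Poly_Mapping.keys q \<Longrightarrow>
    straight (monomial u * r * monomial v) = 0"
  shows "straight (p * r * q) = 0"
proof -
  have left: "straight (monomial u * r * q) = 0" if "Word u \<in> Poly_Mapping.keys p" for u
  proof -
    have "q \<in> {q. straight (monomial u * r * q * 1) = 0}"
      by (rule in_free_subspaceI[OF subspace_straight_kernel]) (use assms that in simp)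
    then show ?thesis by simp
  qed
  have "p \<in> {p. straight (1 * p * (r * q)) = 0}"
    by (rule in_free_subspaceI[OF subspace_straight_kernel]) (use left in \<open>simp add: mult.assoc\<close>)
  then show ?thesis by (simp add: mult.assoc)
qed

text \<open>The diamond lemma. Disjoint descents can be resolved one after the other in either order, the
  mixed bracket terms being shorter words. For overlapping descents \<open>c b a\<close> both routes end in \<open>a b c\<close>, and the
  difference of the collected bracket terms is a sum of commutator defects of shorter words by the
  Jacobi identity.\<close>

lemma resolutions_agree:
  assumes IH: "\<And>w'. (w', w) \<in> measures [length, inversions] \<Longrightarrow> set w' \<subseteq> B \<Longrightarrow> resolvable w'"
    and w: "set w \<subseteq> B" "w = u @ b # a # v" "w = u' @ b' # a' # v'"
    and lt: "a \<prec> b" "a' \<prec> b'" and len: "length u < length u'"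
  shows "resolution u b a v = resolution u' b' a' v'"
proof -
  have short: "resolvable w'" if "length w' < length w" "set w' \<subseteq> B" for w'
    by (rule IH) (use that in auto)
  have fewer: "straighten w' = resolution x d c y"
    if "length w' = length w" "inversions w' < inversions w" "set w' \<subseteq> B" "w' = x @ d # c # y" "c \<prec> d"
    for w' x d c y
    using IH[of w'] that by (simp add: resolvable_def)
  have kill: "straight (p * comm_defect x y * q) = 0"
    if "p \<in> basis_words i" "q \<in> basis_words j" "i + j + 2 < length w" for p q i j x y
  proof (rule straight_zero_bilinear)
    fix u v assume "Word u \<in> Poly_Mapping.keys p" "Word v \<in> Poly_Mapping.keys q"
    then have "set u \<subseteq> B \<and> length u \<le> i" "set v \<subseteq> B \<and> length v \<le> j"
      using that(1,2) supported_onD by blast+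
    then show "straight (monomial u * comm_defect x y * monomial v) = 0"
      using straight_comm_defect_words[OF short, where u = u and v = v] that(3) by simp
  qed
  have monomial_words: "monomial z \<in> basis_words (length z)" if "set z \<subseteq> B" for z
    using that by simp
  obtain us where us: "u' = u @ us" "us \<noteq> []" "us @ b' # a' # v' = b # a # v"
    using w(2,3) len by (auto simp: append_eq_append_conv2)
  then obtain z where z: "u' = u @ b # z" by (cases us) auto
  show ?thesis
  proof (cases z)
    case Nil
    \<comment> \<open>The descents share a letter: the word contains \<open>c b' a'\<close> with \<open>a' \<prec> b' \<prec> c\<close>.\<close>
    define c where "c = b"
    have eq: "a = b'" "v = a' # v'" using w z Nil by auto
    have weq: "w = u @ c # b' # a' # v'" using w z Nil by (simp add: c_def)
    have inB: "a' \<in> B" "b' \<in> B" "c \<in> B" "set u \<subseteq> B" "set v' \<subseteq> B" using w(1) weq by auto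
    have lts: "a' \<prec> b'" "b' \<prec> c" "a' \<prec> c" using lt eq lt_trans by (auto simp: c_def)
    have inv: "inversions (u @ b' # c # a' # v') < inversions w"
      "inversions (u @ b' # a' # c # v') < inversions w"
      "inversions (u @ c # a' # b' # v') < inversions w"
      "inversions (u @ a' # c # b' # v') < inversions w"
      using inversions_swap[of b' c u "a' # v'"] inversions_swap[of a' c "u @ [b']" v']
        inversions_swap[of a' b' "u @ [c]" v'] inversions_swap[of a' c u "b' # v'"] lts
      by (auto simp: weq)
    have s1: "straighten (u @ b' # c # a' # v') = resolution (u @ [b']) c a' v'"
      by (rule fewer) (use inB lts inv in \<open>auto simp: weq\<close>)
    have s2: "straighten (u @ b' # a' # c # v') = resolution u b' a' (c # v')"
      by (rule fewer) (use inB lts inv in \<open>auto simp: weq\<close>)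
    have s3: "straighten (u @ c # a' # b' # v') = resolution u c a' (b' # v')"
      by (rule fewer) (use inB lts inv in \<open>auto simp: weq\<close>)
    have s4: "straighten (u @ a' # c # b' # v') = resolution (u @ [a']) c b' v'"
      by (rule fewer) (use inB lts inv in \<open>auto simp: weq\<close>)
    have k: "straight (monomial u * comm_defect x y * monomial v') = 0" for x y
      by (rule kill) (use inB monomial_words in \<open>auto simp: weq\<close>)
    have jac: "expand (bracket (bracket c b') a') + expand (bracket b' (bracket c a'))
        + expand (bracket (bracket b' a') c) = 0"
      using jacobi_reverse[of c b' a'] by (simp add: expand_zero flip: expand_add)
    \<comment> \<open>The bracket terms collected on the first route minus those collected on the second.\<close>
    define X where "X = (expand (bracket c b') * gen a' + gen b' * expand (bracket c a') + expand (bracket b' a') * gen c)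
      - (gen c * expand (bracket b' a') + expand (bracket c a') * gen b' + gen a' * expand (bracket c b'))"
    have "X = comm_defect (bracket c b') a' + comm_defect b' (bracket c a') + comm_defect (bracket b' a') c
      + (expand (bracket (bracket c b') a') + expand (bracket b' (bracket c a'))
        + expand (bracket (bracket b' a') c))"
      using inB by (simp add: X_def comm_defect_def expand_basis)
    then have "straight (monomial u * X * monomial v') = 0"
      unfolding jac by (simp add: distrib_left distrib_right linear_extension_add k)
    moreover have "resolution u b a v = straighten (u @ a' # b' # c # v')
      + straight (monomial u * (expand (bracket c b') * gen a' + gen b' * expand (bracket c a') + expand (bracket b' a') * gen c) * monomial v')"
      using s1 s2 by (simp add: resolution_def eq c_def linear_extension_add monomial_append monomial_Cons monomial_Nil mult.assoc
          distrib_left distrib_right add.assoc)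
    moreover have "resolution u' b' a' v' = straighten (u @ a' # b' # c # v')
      + straight (monomial u * (gen c * expand (bracket b' a') + expand (bracket c a') * gen b' + gen a' * expand (bracket c b')) * monomial v')"
      using s3 s4 z Nil by (simp add: resolution_def c_def linear_extension_add monomial_append monomial_Cons monomial_Nil mult.assoc
          distrib_left distrib_right ac_simps)
    ultimately show ?thesis
      by (simp add: X_def right_diff_distrib left_diff_distrib linear_extension_diff)
  next
    case (Cons a0 t)
    \<comment> \<open>The descents are disjoint, with the word \<open>t\<close> between them.\<close>
    have eq: "a0 = a" "v = t @ b' # a' # v'" using w z Cons by auto
    have u': "u' = u @ b # a # t" using z Cons eq by simp
    have weq: "w = u @ b # a # t @ b' # a' # v'" using w eq by simp
    have inB: "a \<in> B" "b \<in> B" "a' \<in> B" "b' \<in> B" "set u \<subseteq> B" "set t \<subseteq> B" "set v' \<subseteq> B"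
      using w(1) weq by auto
    have inv: "inversions (u @ a # b # t @ b' # a' # v') < inversions w"
      "inversions (u @ b # a # t @ a' # b' # v') < inversions w"
      using inversions_swap[of a b u "t @ b' # a' # v'"] inversions_swap[of a' b' "u @ b # a # t" v'] lt
      by (auto simp: weq)
    have s1: "straighten (u @ a # b # t @ b' # a' # v') = resolution (u @ a # b # t) b' a' v'"
      by (rule fewer) (use inB lt inv in \<open>auto simp: weq\<close>)
    have s2: "straighten (u @ b # a # t @ a' # b' # v') = resolution u b a (t @ a' # b' # v')"
      by (rule fewer) (use inB lt inv in \<open>auto simp: weq\<close>)
    let ?x = "expand (bracket b a)" and ?y = "expand (bracket b' a')"
    have k1: "straight ((monomial u * ?x * monomial t) * comm_defect b' a' * monomial v') = 0"
    proof (rule kill)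
      show "monomial u * ?x * monomial t \<in> basis_words (length u + 1 + length t)"
        by (intro basis_words_mult expand_supported_on_basis monomial_words inB)
    qed (use inB monomial_words in \<open>auto simp: weq\<close>)
    have k2: "straight (monomial u * comm_defect b a * (monomial t * ?y * monomial v')) = 0"
    proof (rule kill)
      show "monomial t * ?y * monomial v' \<in> basis_words (length t + 1 + length v')"
        by (intro basis_words_mult expand_supported_on_basis monomial_words inB)
    qed (use inB monomial_words in \<open>auto simp: weq\<close>)
    have k1': "straight (monomial u * (?x * (monomial t * (gen b' * (gen a' * monomial v'))))) =
      straight (monomial u * (?x * (monomial t * (gen a' * (gen b' * monomial v'))))) + straight (monomial u * (?x * (monomial t * (?y * monomial v'))))"
      using k1 inB by (simp add: comm_defect_def expand_basis right_diff_distrib left_diff_distrib linear_extension_diff mult.assoc diff_eq_eq add.commute)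
    have k2': "straight (monomial u * (gen b * (gen a * (monomial t * (?y * monomial v'))))) =
      straight (monomial u * (gen a * (gen b * (monomial t * (?y * monomial v'))))) + straight (monomial u * (?x * (monomial t * (?y * monomial v'))))"
      using k2 inB by (simp add: comm_defect_def expand_basis right_diff_distrib left_diff_distrib linear_extension_diff mult.assoc diff_eq_eq add.commute)
    show ?thesis
      using s1 s2 k1' k2' by (simp add: resolution_def eq u' monomial_append monomial_Cons mult.assoc ac_simps)
  qed
qed

lemma resolvable_basis_word: "set w \<subseteq> B \<Longrightarrow> resolvable w"
proof (induction w rule: wf_induct_rule[OF wf_measures[of "[length, inversions]"]])
  case (1 w)
  show ?case
    unfolding resolvable_def
  proof (intro allI impI)
    fix u b a v assume w: "w = u @ b # a # v" and "a \<prec> b"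
    then have "has_descent w" by (auto simp: has_descent_def)
    then obtain u' b' a' v' where w': "w = u' @ b' # a' # v'" "a' \<prec> b'" "straighten w = resolution u' b' a' v'"
      by (rule straighten_some_descent)
    have "resolution u b a v = resolution u' b' a' v'"
    proof (cases "length u" "length u'" rule: linorder_cases)
      case less
      show ?thesis by (rule resolutions_agree[OF _ "1.prems" w w'(1) \<open>a \<prec> b\<close> w'(2) less]) (use "1.IH" in auto)
    next
      case equal
      then show ?thesis using w w'(1) by auto
    next
      case greater
      show ?thesis
        by (rule resolutions_agree[symmetric, OF _ "1.prems" w'(1) w w'(2) \<open>a \<prec> b\<close> greater]) (use "1.IH" in auto)
    qed
    then show "straighten w = resolution u b a v" using w' by simp
  qed
qed

subsection \<open>The projection and its kernel\<close>

text \<open>The algebra endomorphism that expands every letter in the basis.\<close>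

definition substitute :: "('l free_word \<Rightarrow>\<^sub>0 'f) \<Rightarrow> ('l free_word \<Rightarrow>\<^sub>0 'f)" where
  "substitute = linear_extension (\<lambda>w. prod_list (map expand w))"

definition pbw :: "('l free_word \<Rightarrow>\<^sub>0 'f) \<Rightarrow> ('l free_word \<Rightarrow>\<^sub>0 'f)" where
  "pbw p = straight (substitute p)"

lemma substitute_add: "substitute (p + q) = substitute p + substitute q"
  and substitute_diff: "substitute (p - q) = substitute p - substitute q"
  and substitute_zero: "substitute 0 = 0"
  and substitute_fscale: "substitute (fscale c p) = fscale c (substitute p)"
  and substitute_monomial: "substitute (monomial w) = prod_list (map expand w)"
  and substitute_gen: "substitute (gen x) = expand x"
  by (simp_all add: substitute_def linear_extension_add linear_extension_diff linear_extension_fscale gen_eq_monomial)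

lemma substitute_mult: "substitute (p * q) = substitute p * substitute q"
proof -
  have words: "substitute (monomial u * monomial v) = substitute (monomial u) * substitute (monomial v)" for u v
    by (simp add: substitute_monomial flip: monomial_append)
  have left: "substitute (monomial u * q) = substitute (monomial u) * substitute q" for u
  proof -
    have "q \<in> {q. substitute (monomial u * q) = substitute (monomial u) * substitute q}"
    proof (rule in_free_subspaceI)
      show "free.subspace {q. substitute (monomial u * q) = substitute (monomial u) * substitute q}"
        by (rule free.subspaceI) (auto simp: substitute_add substitute_fscale distrib_left fscale_mult_right
            substitute_zero)
    qed (simp add: words)
    then show ?thesis by simp
  qed
  have "p \<in> {p. substitute (p * q) = substitute p * substitute q}"
  proof (rule in_free_subspaceI)
    show "free.subspace {p. substitute (p * q) = substitute p * substitute q}"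
      by (rule free.subspaceI) (auto simp: substitute_add substitute_fscale distrib_right fscale_mult_left
          substitute_zero)
  qed (simp add: left)
  then show ?thesis by simp
qed

lemma substitute_supported_on_basis: "substitute p \<in> supported_on (\<lambda>w. set w \<subseteq> B)"
  unfolding substitute_def
proof (rule linear_extension_in_subspace[OF subspace_supported_on])
  fix w
  show "prod_list (map expand w) \<in> supported_on (\<lambda>w. set w \<subseteq> B)"
  proof (induction w)
    case Nil
    then show ?case by (simp flip: monomial_Nil)
  next
    case (Cons x w)
    have "expand x * prod_list (map expand w) \<in> supported_on (\<lambda>w. set w \<subseteq> B)"
      by (rule supported_on_mult[OF expand_supported_on_basis Cons.IH]) auto
    then show ?case by simp
  qed
qed

lemma pbw_add: "pbw (p + q) = pbw p + pbw q"
  and pbw_diff: "pbw (p - q) = pbw p - pbw q"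
  and pbw_fscale: "pbw (fscale c p) = fscale c (pbw p)"
  by (simp_all add: pbw_def substitute_add substitute_diff substitute_fscale linear_extension_add linear_extension_diff linear_extension_fscale)

lemma subspace_pbw_vimage: "free.subspace W \<Longrightarrow> free.subspace {p. pbw p \<in> W}"
  using pbw_fscale[of 0 0]
  by (intro free.subspaceI) (auto simp: pbw_add pbw_fscale free.subspace_0 free.subspace_add free.subspace_scale)

lemma pbw_relation:
  assumes "r \<in> uea_relations UNIV"
  shows "pbw (u * r * v) = 0"
proof -
  have defect: "straight (p * comm_defect x y * q) = 0"
    if "p \<in> supported_on (\<lambda>w. set w \<subseteq> B)" "q \<in> supported_on (\<lambda>w. set w \<subseteq> B)" for p q x y
  proof (rule straight_zero_bilinear)
    fix u v assume "Word u \<in> Poly_Mapping.keys p" "Word v \<in> Poly_Mapping.keys q"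
    then have "set u \<subseteq> B" "set v \<subseteq> B" using that supported_onD by blast+
    then show "straight (monomial u * comm_defect x y * monomial v) = 0"
      using straight_comm_defect_words[OF resolvable_basis_word, where u = u and v = v
          and n = "length u + length v + 3"] by simp
  qed
  consider x y where "r = gen (x + y) - (gen x + gen y)"
    | c x where "r = gen (scale c x) - fscale c (gen x)"
    | x y where "r = gen x * gen y - gen y * gen x - gen (bracket x y)"
    using assms unfolding uea_relations_def by blast
  then show ?thesis
  proof cases
    case (3 x y)
    then have "substitute r = comm_defect x y"
      by (simp add: substitute_diff substitute_mult substitute_gen comm_defect_def)
    then show ?thesis
      by (simp add: pbw_def substitute_mult defect substitute_supported_on_basis)
  qed (simp_all add: pbw_def substitute_diff substitute_mult substitute_add substitute_gen
      substitute_fscale expand_add expand_scale)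
qed

text \<open>The kernel of \<open>pbw\<close> need not be an ideal a priori, so the argument uses the largest ideal
  contained in it.\<close>

lemma pbw_uea_ideal:
  assumes "p \<in> uea_ideal UNIV"
  shows "pbw p = 0"
proof -
  let ?K = "{p. \<forall>u v. pbw (u * p * v) = 0}"
  have "ideal ?K (free_algebra UNIV)"
  proof (rule ideal_free_algebraI)
    show "free.subspace ?K"
      using pbw_fscale[of 0 0]
      by (intro free.subspaceI) (auto simp: pbw_add pbw_fscale distrib_left distrib_right
          fscale_mult_left fscale_mult_right)
    fix p q assume p: "p \<in> ?K"
    have "pbw (u * (q * p) * v) = 0" "pbw (u * (p * q) * v) = 0" for u v
      using p by (auto simp flip: mult.assoc) (simp add: mult.assoc)
    then show "q * p \<in> ?K \<and> p * q \<in> ?K" by blast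
  qed simp
  moreover have "uea_relations UNIV \<subseteq> ?K" using pbw_relation by blast
  ultimately have "uea_ideal UNIV \<subseteq> ?K" by (rule uea_ideal_minimal)
  with assms have "pbw (1 * p * 1) = 0" by blast
  then show ?thesis by simp
qed

text \<open>Each rewriting step adds a multiple of a commutator relation.\<close>

lemma straighten_congruent: "set w \<subseteq> B \<Longrightarrow> straighten w - monomial w \<in> uea_ideal UNIV"
proof (induction w rule: wf_induct_rule[OF wf_measures[of "[length, inversions]"]])
  case (1 w)
  note sub = subspace_uea_ideal
  show ?case
  proof (cases "has_descent w")
    case False
    then show ?thesis by (simp add: straighten_no_descent free.subspace_0[OF sub])
  next
    case True
    then obtain u b a v where w: "w = u @ b # a # v" "a \<prec> b" "straighten w = resolution u b a v"
      by (rule straighten_some_descent)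
    let ?x = "bracket b a"
    have "straighten (u @ a # b # v) - monomial (u @ a # b # v) \<in> uea_ideal UNIV"
      by (rule "1.IH") (use w "1.prems" inversions_swap in auto)
    moreover have "straight (monomial u * expand ?x * monomial v) - monomial u * expand ?x * monomial v \<in> uea_ideal UNIV"
    proof -
      have "monomial u * expand ?x * monomial v \<in> {p. straight p - p \<in> uea_ideal UNIV}"
      proof (rule in_free_subspaceI)
        have "0 \<in> uea_ideal UNIV" by (rule free.subspace_0[OF sub])
        moreover have "(straight p + straight q) - (p + q) \<in> uea_ideal UNIV"
          if "straight p - p \<in> uea_ideal UNIV" "straight q - q \<in> uea_ideal UNIV" for p q
          using free.subspace_add[OF sub that] by (simp add: algebra_simps)
        moreover have "fscale c (straight p) - fscale c p \<in> uea_ideal UNIV"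
          if "straight p - p \<in> uea_ideal UNIV" for p c
          using free.subspace_scale[OF sub that, of c] by (simp add: free.scale_right_diff_distrib)
        ultimately show "free.subspace {p. straight p - p \<in> uea_ideal UNIV}"
          by (intro free.subspaceI) (auto simp: linear_extension_add linear_extension_fscale)
        fix z assume z: "Word z \<in> Poly_Mapping.keys (monomial u * expand ?x * monomial v)"
        have "monomial u * expand ?x * monomial v \<in> basis_words (length u + 1 + length v)"
          by (intro basis_words_mult expand_supported_on_basis) (use w "1.prems" in auto)
        from supported_onD[OF this z] show "monomial z \<in> {p. straight p - p \<in> uea_ideal UNIV}"
          using "1.IH"[of z] w by auto
      qed
      then show ?thesis by simp
    qed
    moreover have "monomial u * (expand b * expand a - expand a * expand b - expand ?x) * monomial v \<in> uea_ideal UNIV"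
    proof (rule uea_ideal_mult(2)[OF uea_ideal_mult(1)])
      have "(gen b * gen a - gen a * gen b - gen ?x) - (expand ?x - gen ?x) \<in> uea_ideal UNIV"
        by (rule free.subspace_diff[OF sub gen_bracket_relation expand_eq_gen])
      then show "expand b * expand a - expand a * expand b - expand ?x \<in> uea_ideal UNIV"
        using w "1.prems" by (simp add: expand_basis)
    qed
    ultimately have "(straighten (u @ a # b # v) - monomial (u @ a # b # v)) +
      (straight (monomial u * expand ?x * monomial v) - monomial u * expand ?x * monomial v) -
      monomial u * (expand b * expand a - expand a * expand b - expand ?x) * monomial v \<in> uea_ideal UNIV"
      by (rule free.subspace_diff[OF sub free.subspace_add[OF sub]])
    also have "(straighten (u @ a # b # v) - monomial (u @ a # b # v)) +
      (straight (monomial u * expand ?x * monomial v) - monomial u * expand ?x * monomial v) -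
      monomial u * (expand b * expand a - expand a * expand b - expand ?x) * monomial v
      = straighten w - monomial w"
      using w "1.prems" by (simp add: resolution_def expand_basis monomial_append monomial_Cons
          right_diff_distrib left_diff_distrib mult.assoc)
    finally show ?thesis .
  qed
qed

lemma pbw_congruent: "pbw p - p \<in> uea_ideal UNIV"
proof -
  note sub = subspace_uea_ideal
  have sub_P: "free.subspace {p. F p - p \<in> uea_ideal UNIV}"
    if "\<And>p q. F (p + q) = F p + F q" "\<And>c p. F (fscale c p) = fscale c (F p)" for F
  proof (rule free.subspaceI)
    show "0 \<in> {p. F p - p \<in> uea_ideal UNIV}" using that(2)[of 0 0] free.subspace_0[OF sub] by simp
    fix p q assume "p \<in> {p. F p - p \<in> uea_ideal UNIV}" "q \<in> {p. F p - p \<in> uea_ideal UNIV}"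
    then have "(F p - p) + (F q - q) \<in> uea_ideal UNIV" by (intro free.subspace_add[OF sub]) auto
    then show "p + q \<in> {p. F p - p \<in> uea_ideal UNIV}" by (simp add: that algebra_simps)
    fix c
    have "fscale c (F p - p) \<in> uea_ideal UNIV" using \<open>p \<in> _\<close> by (intro free.subspace_scale[OF sub]) auto
    then show "fscale c p \<in> {p. F p - p \<in> uea_ideal UNIV}"
      by (simp add: that free.scale_right_diff_distrib)
  qed
  have "substitute p \<in> {p. straight p - p \<in> uea_ideal UNIV}"
  proof (rule in_free_subspaceI)
    show "free.subspace {p. straight p - p \<in> uea_ideal UNIV}"
      by (rule sub_P) (simp_all add: linear_extension_add linear_extension_fscale)
    fix w assume "Word w \<in> Poly_Mapping.keys (substitute p)"
    then have "set w \<subseteq> B" by (rule supported_onD[OF substitute_supported_on_basis])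
    then show "monomial w \<in> {p. straight p - p \<in> uea_ideal UNIV}" by (simp add: straighten_congruent)
  qed
  moreover have "p \<in> {p. substitute p - p \<in> uea_ideal UNIV}"
  proof (rule in_free_subspaceI)
    show "free.subspace {p. substitute p - p \<in> uea_ideal UNIV}"
      by (rule sub_P) (simp_all add: substitute_add substitute_fscale)
    fix w
    have "prod_list (map expand w) - monomial w \<in> uea_ideal UNIV"
    proof (induction w)
      case Nil
      then show ?case by (simp add: monomial_Nil free.subspace_0[OF sub])
    next
      case (Cons x w)
      have "(expand x - gen x) * prod_list (map expand w) + gen x * (prod_list (map expand w) - monomial w) \<in> uea_ideal UNIV"
        by (intro free.subspace_add[OF sub] uea_ideal_mult expand_eq_gen Cons.IH)
      then show ?case by (simp add: monomial_Cons algebra_simps)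
    qed
    then show "monomial w \<in> {p. substitute p - p \<in> uea_ideal UNIV}" by (simp add: substitute_monomial)
  qed
  ultimately have "(straight (substitute p) - substitute p) + (substitute p - p) \<in> uea_ideal UNIV"
    by (intro free.subspace_add[OF sub]) auto
  then show ?thesis by (simp add: pbw_def)
qed

text \<open>Nondecreasing words in the basis are thus linearly independent modulo the defining ideal,
  which is the Poincare-Birkhoff-Witt theorem.\<close>

lemma pbw_no_descent:
  assumes "set w \<subseteq> B" "\<not> has_descent w"
  shows "pbw (monomial w) = monomial w"
proof -
  have "map expand w = map gen w" using assms(1) by (auto simp: expand_basis)
  then have "substitute (monomial w) = monomial w"
    unfolding substitute_monomial by (simp only: monomial_eq_prod_list)
  then show ?thesis
    using straighten_no_descent[OF assms(2)]
    by (simp add: pbw_def)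
qed

text \<open>A permutation with the least number of inversions has no descent, since swapping a descent
  would lower this number.\<close>

lemma exists_descent_free_permutation:
  obtains w' where "mset w' = mset w" "\<not> has_descent w'"
proof -
  obtain w' where w': "mset w' = mset w" and least: "\<And>z. mset z = mset w \<Longrightarrow> inversions w' \<le> inversions z"
    using arg_min_nat_lemma[of "\<lambda>z. mset z = mset w" w inversions] by blast
  have "\<not> has_descent w'"
  proof
    assume "has_descent w'"
    then obtain u b a v where d: "w' = u @ b # a # v" "a \<prec> b" by (auto simp: has_descent_def)
    have "mset (u @ a # b # v) = mset w'" by (simp add: d(1) add_mset_commute)
    then have "mset (u @ a # b # v) = mset w" using w' by simp
    from least[OF this] inversions_swap[OF d(2), of u v] d(1) show False by simp
  qed
  with w' show ?thesis by (rule that)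
qed

subsection \<open>Straightening does not raise weights\<close>

text \<open>Besides the degree filtrations of \<open>L\<close> and \<open>M\<close>, the constant chain \<open>\<lambda>_. M\<close> for a subalgebra \<open>M\<close> spanned by
  \<open>B \<inter> M\<close> is of this kind; its words of weight \<open>0\<close> are those with letters in \<open>B \<inter> M\<close>.\<close>

definition adapted :: "(nat \<Rightarrow> 'l set) \<Rightarrow> bool" where
  "adapted V \<longleftrightarrow> (\<forall>m n. m \<le> n \<longrightarrow> V m \<subseteq> V n) \<and>
     (\<forall>m n. \<forall>x\<in>V m. \<forall>y\<in>V n. bracket x y \<in> V (m + n)) \<and> (\<forall>n. V n \<subseteq> span (B \<inter> V n))"

definition weighted :: "(nat \<Rightarrow> 'l set) \<Rightarrow> nat \<Rightarrow> 'l list \<Rightarrow> bool" where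
  "weighted V n w \<longleftrightarrow> set w \<subseteq> B \<inter> (\<Union>k. V k) \<and> sum_list (map (weight V) w) \<le> n"

lemma straighten_supported_on:
  assumes swap: "\<And>u b a v. Q (u @ b # a # v) \<Longrightarrow> Q (u @ a # b # v)"
    and bracket: "\<And>u b a v e. Q (u @ b # a # v) \<Longrightarrow> coord (bracket b a) e \<noteq> 0 \<Longrightarrow> Q (u @ e # v)"
  shows "Q w \<Longrightarrow> straighten w \<in> supported_on Q"
proof (induction w rule: wf_induct_rule[OF wf_measures[of "[length, inversions]"]])
  case (1 w)
  show ?case
  proof (cases "has_descent w")
    case False
    with 1 show ?thesis by (simp add: straighten_no_descent)
  next
    case True
    then obtain u b a v where w: "w = u @ b # a # v" "a \<prec> b" "straighten w = resolution u b a v"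
      by (rule straighten_some_descent)
    have "straighten (u @ a # b # v) \<in> supported_on Q"
      by (rule "1.IH") (use w "1.prems" inversions_swap swap in auto)
    moreover have "straighten (u @ e # v) \<in> supported_on Q" if "coord (bracket b a) e \<noteq> 0" for e
      by (rule "1.IH") (use w "1.prems" bracket that in auto)
    ultimately show ?thesis
      unfolding w(3) resolution_def straight_expand
      by (intro free.subspace_add free.subspace_sum free.subspace_scale subspace_supported_on) auto
  qed
qed

text \<open>A basis element occurring in \<open>[b,a]\<close> has weight at most the sum of the weights of \<open>a\<close> and
  \<open>b\<close>, because \<open>[b,a]\<close> lies in the span of the basis elements of at most that weight.\<close>

lemma straighten_weighted:
  assumes V: "adapted V" and w: "weighted V n w"
  shows "straighten w \<in> supported_on (weighted V n)"
proof (rule straighten_supported_on[where Q = "weighted V n", OF _ _ w])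
  fix u b a v assume Q: "weighted V n (u @ b # a # v)"
  then show "weighted V n (u @ a # b # v)" by (auto simp: weighted_def)
  fix e assume e: "coord (bracket b a) e \<noteq> 0"
  let ?k = "weight V b + weight V a"
  have "b \<in> (\<Union>k. V k)" "a \<in> (\<Union>k. V k)" using Q by (auto simp: weighted_def)
  then have "b \<in> V (weight V b)" "a \<in> V (weight V a)" by (simp_all only: weight_mem)
  then have "bracket b a \<in> V ?k" using V by (auto simp: adapted_def)
  then have "bracket b a \<in> span (B \<inter> V ?k)" using V by (auto simp: adapted_def)
  then have "coord (bracket b a) = representation (B \<inter> V ?k) (bracket b a)"
    by (intro representation_extend independent_B) auto
  with e have "e \<in> B \<inter> V ?k" by (intro representation_ne_zero) simp
  then show "weighted V n (u @ e # v)"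
    using Q weight_le[of e V ?k] by (auto simp: weighted_def)
qed

lemma pbw_weighted:
  assumes V: "adapted V" and xs: "list_all2 (\<lambda>x k. x \<in> V k) xs ks" and n: "sum_list ks \<le> n"
  shows "pbw (monomial xs) \<in> supported_on (weighted V n)"
proof -
  have "prod_list (map expand xs) \<in> supported_on (weighted V (sum_list ks))"
    using xs
  proof (induction rule: list_all2_induct)
    case Nil
    then show ?case by (simp add: weighted_def flip: monomial_Nil)
  next
    case (Cons x xs k ks)
    have "x \<in> span (B \<inter> V k)" using V Cons(1) by (auto simp: adapted_def)
    then have "expand x \<in> supported_on (\<lambda>w. \<exists>e\<in>B \<inter> V k. w = [e])" by (rule expand_supported_on) auto
    then have "expand x * prod_list (map expand xs) \<in> supported_on (weighted V (k + sum_list ks))"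
    proof (rule supported_on_mult[OF _ Cons.IH])
      fix u v assume "\<exists>e\<in>B \<inter> V k. u = [e]" "weighted V (sum_list ks) v"
      then show "weighted V (k + sum_list ks) (u @ v)"
        by (auto simp: weighted_def intro!: add_mono weight_le)
    qed
    then show ?case by simp
  qed
  moreover have "supported_on (weighted V (sum_list ks)) \<subseteq> supported_on (weighted V n)"
    using n by (intro supported_on_mono) (auto simp: weighted_def)
  ultimately have *: "prod_list (map expand xs) \<in> supported_on (weighted V n)" by blast
  show ?thesis
    unfolding pbw_def substitute_monomial
  proof (rule linear_extension_in_subspace[OF subspace_supported_on])
    fix w assume "Word w \<in> Poly_Mapping.keys (prod_list (map expand xs))"
    then have "weighted V n w" by (rule supported_onD[OF *])
    then show "straighten w \<in> supported_on (weighted V n)" by (rule straighten_weighted[OF V])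
  qed
qed

end

section \<open>Bases adapted to a filtration\<close>

context vector_space
begin

lemma independent_Un_disjoint_spans:
  assumes S: "independent S" and T: "independent T" and ST: "span S \<inter> span T \<subseteq> {0}"
  shows "independent (S \<union> T)"
proof -
  have disj: "S \<inter> T = {}"
  proof (rule ccontr)
    assume "S \<inter> T \<noteq> {}"
    then obtain x where "x \<in> S" "x \<in> T" by blast
    then have "x = 0" using ST span_base by blast
    then show False using S \<open>x \<in> S\<close> dependent_zero by blast
  qed
  show ?thesis
    unfolding independent_explicit_finite_subsets
  proof (intro allI impI)
    fix R u assume R: "R \<subseteq> S \<union> T" "finite R" and sum: "(\<Sum>v\<in>R. u v *s v) = 0"
    let ?s = "\<Sum>v\<in>R \<inter> S. u v *s v" and ?t = "\<Sum>v\<in>R \<inter> T. u v *s v"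
    have "R = (R \<inter> S) \<union> (R \<inter> T)" using R by blast
    then have "?s + ?t = 0"
      using sum sum.union_disjoint[of "R \<inter> S" "R \<inter> T" "\<lambda>v. u v *s v"] R disj by auto
    moreover have "?s \<in> span S" "?t \<in> span T" by (auto intro!: span_sum span_scale intro: span_base)
    ultimately have "?s \<in> span S \<inter> span T"
      using span_neg[of ?t T] by (simp add: eq_neg_iff_add_eq_0[symmetric])
    then have "?s = 0" using ST by blast
    then have "?t = 0" using \<open>?s + ?t = 0\<close> by simp
    have "\<forall>v\<in>R \<inter> S. u v = 0"
      using S \<open>?s = 0\<close> R unfolding independent_explicit_finite_subsets by blast
    moreover have "\<forall>v\<in>R \<inter> T. u v = 0"
      using T \<open>?t = 0\<close> R unfolding independent_explicit_finite_subsets by blast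
    ultimately show "\<forall>v\<in>R. u v = 0" using R by blast
  qed
qed

lemma span_disjoint_subsets_of_independent:
  assumes B: "independent B" and ST: "S \<subseteq> B" "T \<subseteq> B" "S \<inter> T = {}"
  shows "span S \<inter> span T \<subseteq> {0}"
proof
  fix x assume x: "x \<in> span S \<inter> span T"
  have "representation B x = representation S x" "representation B x = representation T x"
    using x by (auto intro!: representation_extend B ST)
  then have "representation B x e = 0" for e
    using representation_ne_zero[of S x e] representation_ne_zero[of T x e] ST(3) by auto
  moreover have "x \<in> span B" using x span_mono[OF ST(1)] by blast
  ultimately show "x \<in> {0}" using sum_nonzero_representation_eq[OF B, of x] by simp
qed

text \<open>A basis built step by step along the chain. The seeds \<open>T n\<close> enter at step \<open>n + 1\<close>; the last
  hypothesis holds in particular if they are independent modulo \<open>V n\<close>.\<close>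

lemma adapted_basis_exists:
  fixes V T :: "nat \<Rightarrow> 'b set"
  assumes V: "\<And>n. subspace (V n)" "\<And>n. V n \<subseteq> V (Suc n)" "V 0 = {0}"
    and T: "\<And>n. T n \<subseteq> V (Suc n)"
      "\<And>n S. independent S \<Longrightarrow> span S = V n \<Longrightarrow> independent (S \<union> T n)"
  obtains B where "independent B" "\<And>n. V n \<subseteq> span (B \<inter> V n)" "\<And>n. T n \<subseteq> B" "B \<subseteq> (\<Union>n. V n)"
proof -
  have "\<exists>f. \<forall>n. (independent (f n) \<and> span (f n) = V n) \<and> f n \<union> T n \<subseteq> f (Suc n)"
  proof (rule dependent_nat_choice)
    show "\<exists>S. independent S \<and> span S = V 0" using V(3) by (intro exI[of _ "{}"]) (simp add: independent_empty)
    fix S n assume S: "independent S \<and> span S = V n"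
    then have "S \<union> T n \<subseteq> V (Suc n)" using T(1) V(2) span_superset by blast
    moreover have "independent (S \<union> T n)" using S T(2) by blast
    ultimately obtain S' where S': "S \<union> T n \<subseteq> S'" "S' \<subseteq> V (Suc n)" "independent S'" "V (Suc n) \<subseteq> span S'"
      by (rule maximal_independent_subset_extend)
    have "span S' = V (Suc n)"
      using S' span_minimal[OF S'(2) V(1)] by blast
    with S' show "\<exists>S'. (independent S' \<and> span S' = V (Suc n)) \<and> S \<union> T n \<subseteq> S'" by blast
  qed
  then obtain f where f: "\<And>n. independent (f n)" "\<And>n. span (f n) = V n" "\<And>n. f n \<union> T n \<subseteq> f (Suc n)"
    by blast
  have mono: "f m \<subseteq> f n" if "m \<le> n" for m n
    by (rule lift_Suc_mono_le[OF _ that]) (use f(3) in blast)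
  show ?thesis
  proof (rule that[of "\<Union>n. f n"])
    show "independent (\<Union>n. f n)"
    proof (rule independent_Union_directed)
      fix c d assume "c \<in> range f" "d \<in> range f"
      then show "c \<subseteq> d \<or> d \<subseteq> c" using mono by (metis imageE nat_le_linear)
    qed (use f(1) in auto)
    show "V n \<subseteq> span ((\<Union>n. f n) \<inter> V n)" for n
    proof -
      have "f n \<subseteq> (\<Union>n. f n) \<inter> V n" using f(2) span_superset by blast
      then show ?thesis using span_mono f(2) by metis
    qed
    show "T n \<subseteq> (\<Union>n. f n)" for n using f(3) by blast
    show "(\<Union>n. f n) \<subseteq> (\<Union>n. V n)" using f(2) span_superset by blast
  qed
qed

end

section \<open>The degree filtration of a Lie algebra\<close>

context lie_algebra
begin

lemma subspace_lie_filt: "subspace (lie_filt X n)"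
  by (simp add: lie_filt_def)

lemma lie_filt_mono: "m \<le> n \<Longrightarrow> lie_filt X m \<subseteq> lie_filt X n"
  unfolding lie_filt_def by (intro span_mono) (auto intro: order_trans)

lemma lie_commutator_pos: "lie_commutator X k x \<Longrightarrow> 0 < k"
  by (induction rule: lie_commutator.induct) auto

lemma lie_filt_0: "lie_filt X 0 = {0}"
proof -
  have "{x. \<exists>k\<le>0. lie_commutator X k x} = {}" using lie_commutator_pos by blast
  then show ?thesis by (simp only: lie_filt_def span_empty)
qed

lemma lie_commutator_in_lie_filt: "lie_commutator X k x \<Longrightarrow> k \<le> n \<Longrightarrow> x \<in> lie_filt X n"
  unfolding lie_filt_def by (intro span_base) blast

lemma lie_filt_bracket:
  assumes x: "x \<in> lie_filt X m" and y: "y \<in> lie_filt X n"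
  shows "bracket x y \<in> lie_filt X (m + n)"
proof -
  note sub = subspace_lie_filt[of X "m + n"]
  have zero: "bracket 0 y = 0" "bracket x 0 = 0" for x y
    using bracket_scale_left[of 0 0 y] bracket_scale_right[of x 0 0] by simp_all
  have comm: "bracket x y \<in> lie_filt X (m + n)" if y: "y \<in> {y. \<exists>k\<le>n. lie_commutator X k y}" for y
    using x unfolding lie_filt_def[of X m]
  proof (rule span_induct)
    show "subspace {x. bracket x y \<in> lie_filt X (m + n)}"
      by (rule subspaceI) (auto simp: bracket_add_left bracket_scale_left zero subspace_0[OF sub]
          subspace_add[OF sub] subspace_scale[OF sub])
    fix x assume "x \<in> {x. \<exists>k\<le>m. lie_commutator X k x}"
    with y show "bracket x y \<in> lie_filt X (m + n)"
      by (auto intro!: lie_commutator_in_lie_filt[OF lie_commutator.bracket] add_mono)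
  qed
  show ?thesis
    using y unfolding lie_filt_def[of X n]
  proof (rule span_induct)
    show "subspace {y. bracket x y \<in> lie_filt X (m + n)}"
      by (rule subspaceI) (auto simp: bracket_add_right bracket_scale_right zero subspace_0[OF sub]
          subspace_add[OF sub] subspace_scale[OF sub])
  qed (rule comm)
qed

lemma lie_filt_subset:
  assumes "lie_subalgebra M" "X \<subseteq> M"
  shows "lie_filt X n \<subseteq> M"
proof -
  have "x \<in> M" if "lie_commutator X k x" for k x
    using that by induction (use assms in \<open>auto simp: lie_subalgebra_def\<close>)
  then show ?thesis
    unfolding lie_filt_def using assms(1) by (intro span_minimal) (auto simp: lie_subalgebra_def)
qed

lemma generated_subset_UN_lie_filt: "lie_subalgebra hull X \<subseteq> (\<Union>n. lie_filt X n)"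
proof (rule hull_minimal)
  show "X \<subseteq> (\<Union>n. lie_filt X n)"
    using lie_commutator_in_lie_filt[OF lie_commutator.generator, of _ X 1] by blast
  have common: "\<exists>k. x \<in> lie_filt X k \<and> y \<in> lie_filt X k"
    if "x \<in> lie_filt X m" "y \<in> lie_filt X n" for x y m n
    using that lie_filt_mono[of m "max m n" X] lie_filt_mono[of n "max m n" X] by (intro exI[of _ "max m n"]) auto
  show "lie_subalgebra (\<Union>n. lie_filt X n)"
    unfolding lie_subalgebra_def
  proof (intro conjI ballI)
    show "subspace (\<Union>n. lie_filt X n)"
    proof (rule subspaceI)
      fix x y assume "x \<in> (\<Union>n. lie_filt X n)" "y \<in> (\<Union>n. lie_filt X n)"
      then obtain k where "x \<in> lie_filt X k" "y \<in> lie_filt X k" using common by blast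
      then have "x + y \<in> lie_filt X k" by (rule subspace_add[OF subspace_lie_filt])
      then show "x + y \<in> (\<Union>n. lie_filt X n)" by blast
      fix c
      have "scale c x \<in> lie_filt X k" by (rule subspace_scale[OF subspace_lie_filt \<open>x \<in> lie_filt X k\<close>])
      then show "scale c x \<in> (\<Union>n. lie_filt X n)" by blast
    next
      show "0 \<in> (\<Union>n. lie_filt X n)" by (simp add: subspace_0[OF subspace_lie_filt])
    qed
    fix x y assume "x \<in> (\<Union>n. lie_filt X n)" "y \<in> (\<Union>n. lie_filt X n)"
    then show "bracket x y \<in> (\<Union>n. lie_filt X n)" using lie_filt_bracket by blast
  qed
qed

lemma lie_generatesD:
  assumes "lie_generates X M" "lie_subalgebra M"
  shows "X \<subseteq> M" "(\<Union>n. lie_filt X n) = M"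
proof -
  show "X \<subseteq> M" using assms(1) hull_subset[of X lie_subalgebra] by (simp add: lie_generates_def)
  then show "(\<Union>n. lie_filt X n) = M"
    using lie_filt_subset[OF assms(2)] generated_subset_UN_lie_filt[of X] assms(1)
    by (auto simp: lie_generates_def)
qed

lemma finite_lie_commutators:
  assumes "finite X"
  shows "finite {x. lie_commutator X k x}"
proof (induction k rule: less_induct)
  case (less k)
  have "{x. lie_commutator X k x} \<subseteq> X \<union>
    (\<Union>i\<in>{..<k}. \<Union>j\<in>{..<k}. (\<lambda>(x, y). bracket x y) ` ({x. lie_commutator X i x} \<times> {y. lie_commutator X j y}))"
  proof
    fix x assume "x \<in> {x. lie_commutator X k x}"
    then have "lie_commutator X k x" by simp
    then show "x \<in> X \<union>
      (\<Union>i\<in>{..<k}. \<Union>j\<in>{..<k}. (\<lambda>(x, y). bracket x y) ` ({x. lie_commutator X i x} \<times> {y. lie_commutator X j y}))"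
    proof cases
      case (bracket i y j z)
      then have "0 < i" "0 < j" by (auto dest: lie_commutator_pos)
      then have "i \<in> {..<k}" "j \<in> {..<k}" using bracket by auto
      moreover have "x \<in> (\<lambda>(x, y). bracket x y) ` ({x. lie_commutator X i x} \<times> {y. lie_commutator X j y})"
        using bracket by (intro image_eqI[of _ _ "(y, z)"]) auto
      ultimately show ?thesis by blast
    qed simp
  qed
  then show ?case
    by (rule finite_subset) (auto intro!: assms finite_imageI finite_cartesian_product less)
qed

text \<open>There are finitely many commutators of bounded length, so \<open>M \<inter> L\<^sub>n\<close> has a finite basis, which
  lies in a single term of the increasing filtration of \<open>M\<close>.\<close>

lemma lie_distortion_finite:
  assumes X: "finite X" and Y: "lie_generates Y M" "lie_subalgebra M"
  shows "\<exists>m. M \<inter> lie_filt X n \<subseteq> lie_filt Y m"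
proof -
  let ?G = "{x. \<exists>k\<le>n. lie_commutator X k x}"
  have "?G = (\<Union>k\<in>{..n}. {x. lie_commutator X k x})" by auto
  then have fin: "finite ?G" using finite_lie_commutators[OF X] by auto
  obtain S where S: "S \<subseteq> M \<inter> lie_filt X n" "independent S" "M \<inter> lie_filt X n \<subseteq> span S"
    by (rule maximal_independent_subset)
  have "S \<subseteq> span ?G" using S(1) by (auto simp: lie_filt_def)
  then have "finite S" using independent_span_bound[OF fin S(2)] by blast
  moreover have "\<forall>s\<in>S. \<exists>m. s \<in> lie_filt Y m" using S(1) lie_generatesD(2)[OF Y] by blast
  ultimately obtain k where k: "\<And>s. s \<in> S \<Longrightarrow> s \<in> lie_filt Y (k s)" by metis
  define m where "m = Max (insert 0 (k ` S))"
  have "S \<subseteq> lie_filt Y m"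
  proof
    fix s assume s: "s \<in> S"
    have "k s \<le> m" unfolding m_def using \<open>finite S\<close> s by (intro Max_ge) auto
    then show "s \<in> lie_filt Y m" using k[OF s] lie_filt_mono by blast
  qed
  then have "span S \<subseteq> lie_filt Y m" by (intro span_minimal subspace_lie_filt)
  then show ?thesis using S(3) by blast
qed

text \<open>As for associative algebras: a common degree bound for the generators is multiplied by the
  length of a commutator.\<close>

lemma lie_filt_linear_comparison:
  assumes "finite X" "X \<subseteq> (\<Union>n. lie_filt Y n)"
  obtains c where "\<And>n. lie_filt X n \<subseteq> lie_filt Y (c * n)"
proof -
  have "\<forall>x\<in>X. \<exists>m. x \<in> lie_filt Y m" using assms(2) by blast
  then obtain k where k: "\<And>x. x \<in> X \<Longrightarrow> x \<in> lie_filt Y (k x)" by metis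
  define c where "c = Max (insert 0 (k ` X))"
  have comm: "x \<in> lie_filt Y (c * m)" if "lie_commutator X m x" for m x
    using that
  proof induction
    case (generator x)
    have "k x \<le> c" unfolding c_def using assms(1) generator by (intro Max_ge) auto
    then have "k x \<le> c * 1" by simp
    then show ?case using k[OF generator] lie_filt_mono by blast
  next
    case (bracket m x n y)
    then show ?case using lie_filt_bracket by (simp add: distrib_left)
  qed
  have "lie_filt X n \<subseteq> lie_filt Y (c * n)" for n
    unfolding lie_filt_def[of X]
  proof (intro span_minimal subspace_lie_filt subsetI)
    fix x assume "x \<in> {x. \<exists>k\<le>n. lie_commutator X k x}"
    then obtain m where m: "m \<le> n" "lie_commutator X m x" by blast
    then have "c * m \<le> c * n" by simp
    then show "x \<in> lie_filt Y (c * n)" using comm[OF m(2)] lie_filt_mono by blast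
  qed
  then show ?thesis by (rule that)
qed

lemma lie_dist_eq_func_class:
  assumes M: "lie_subalgebra M"
    and X: "finite X" "lie_generates X UNIV" and Y: "finite Y" "lie_generates Y M"
  shows "lie_dist M = func_class (distortion (lie_filt X) M (lie_filt Y))"
proof -
  have le: "func_le (distortion (lie_filt X) M (lie_filt Y)) (distortion (lie_filt X') M (lie_filt Y'))"
    if X: "finite X" "lie_generates X UNIV" and Y: "finite Y" "lie_generates Y M"
      and X': "finite X'" "lie_generates X' UNIV" and Y': "finite Y'" "lie_generates Y' M"
    for X Y X' Y'
  proof -
    obtain c where "\<And>n. lie_filt X n \<subseteq> lie_filt X' (c * n)"
      using lie_filt_linear_comparison[OF X(1), of X'] lie_generatesD[OF X'(2) lie_subalgebra_UNIV] by blast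
    moreover obtain e where "\<And>n. lie_filt Y' n \<subseteq> lie_filt Y (e * n)"
      using lie_filt_linear_comparison[OF Y'(1), of Y] lie_generatesD[OF Y(2) M] lie_generatesD[OF Y'(2) M] by blast
    ultimately show ?thesis
      using lie_distortion_finite[OF X'(1) Y'(2) M] lie_filt_mono by (rule distortion_func_le)
  qed
  have "func_class (distortion (lie_filt X') M (lie_filt Y')) = func_class (distortion (lie_filt X) M (lie_filt Y))"
    if "finite X'" "lie_generates X' UNIV" "finite Y'" "lie_generates Y' M" for X' Y'
    using le[OF X Y that] le[OF that X Y] by (intro func_class_eqI) (simp add: func_equiv_def)
  then show ?thesis unfolding lie_dist_def using X Y by blast
qed

end

section \<open>The enveloping algebra as a quotient of the free algebra\<close>

context lie_algebra
begin

definition coset :: "('l free_word \<Rightarrow>\<^sub>0 'f) \<Rightarrow> ('l free_word \<Rightarrow>\<^sub>0 'f) set" where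
  "coset p = uea_ideal UNIV +>\<^bsub>free_algebra UNIV\<^esub> p"

lemma coset_eq: "coset p = {i + p | i. i \<in> uea_ideal UNIV}"
  by (auto simp: coset_def a_r_coset_def')

lemma coset_eq_iff: "coset p = coset q \<longleftrightarrow> p - q \<in> uea_ideal UNIV"
proof
  note sub = subspace_uea_ideal
  assume "coset p = coset q"
  moreover have "p \<in> coset p" using free.subspace_0[OF sub] by (force simp: coset_eq)
  ultimately show "p - q \<in> uea_ideal UNIV" by (auto simp: coset_eq)
next
  note sub = subspace_uea_ideal
  have le: "coset p \<subseteq> coset q" if "p - q \<in> uea_ideal UNIV" for p q
  proof
    fix z assume "z \<in> coset p"
    then obtain i where i: "i \<in> uea_ideal UNIV" "z = i + p" by (auto simp: coset_eq)
    have "i + (p - q) \<in> uea_ideal UNIV" by (rule free.subspace_add[OF sub i(1) that])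
    moreover have "z = (i + (p - q)) + q" using i by simp
    ultimately show "z \<in> coset q" unfolding coset_eq by blast
  qed
  assume pq: "p - q \<in> uea_ideal UNIV"
  then have "q - p \<in> uea_ideal UNIV" using free.subspace_neg[OF sub pq] by simp
  with pq show "coset p = coset q" using le by blast
qed

lemma uea_simps:
  "carrier (uea S) = a_rcosets\<^bsub>free_algebra S\<^esub> (uea_ideal S)"
  "monoid.mult (uea S) = rcoset_mult (free_algebra S) (uea_ideal S)"
  "one (uea S) = uea_ideal S +>\<^bsub>free_algebra S\<^esub> \<one>\<^bsub>free_algebra S\<^esub>"
  "zero (uea S) = uea_ideal S"
  "add (uea S) = set_add (free_algebra S)"
  "smult (uea S) = uea_smult S"
  by (simp_all add: uea_def ring.defs module.defs FactRing_def)

lemma uea_presentation: "algebra_presentation fscale (uea UNIV) coset"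
proof -
  let ?F = "free_algebra UNIV :: ('f, 'l free_word \<Rightarrow>\<^sub>0 'f) module"
  interpret I: ideal "uea_ideal UNIV" ?F by (rule ideal_uea_ideal[OF lie_subalgebra_UNIV])
  note sub = subspace_uea_ideal
  show ?thesis
  proof
    show "fscale c x * y = fscale c (x * y)" "x * fscale c y = fscale c (x * y)"
      for c :: 'f and x y :: "'l free_word \<Rightarrow>\<^sub>0 'f"
      by (simp_all only: fscale_mult_left fscale_mult_right)
    show "carrier (uea UNIV) = range coset"
      by (auto simp: uea_simps A_RCOSETS_def' coset_def)
    show "coset (x + y) = coset x \<oplus>\<^bsub>uea UNIV\<^esub> coset y" for x y
      using I.a_rcos_sum[of x y] by (simp add: uea_simps coset_def)
    show "coset 0 = \<zero>\<^bsub>uea UNIV\<^esub>"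
      by (simp add: uea_simps coset_eq)
    show "coset (x * y) = coset x \<otimes>\<^bsub>uea UNIV\<^esub> coset y" for x y
      using I.rcoset_mult_add[of x y] by (simp add: uea_simps coset_def)
    show "coset 1 = \<one>\<^bsub>uea UNIV\<^esub>" by (simp add: uea_simps coset_def)
    show "coset (fscale c x) = c \<odot>\<^bsub>uea UNIV\<^esub> coset x" for c x
    proof -
      have "coset (fscale c p) = coset (fscale c x)" if "p \<in> coset x" for p
      proof -
        obtain i where "i \<in> uea_ideal UNIV" "p = i + x" using \<open>p \<in> coset x\<close> by (auto simp: coset_eq)
        then show ?thesis
          using free.subspace_scale[OF sub, of i c] by (simp add: coset_eq_iff free.scale_right_distrib)
      qed
      moreover have "x \<in> coset x" using free.subspace_0[OF sub] by (force simp: coset_eq)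
      ultimately have "(\<Union>p\<in>coset x. coset (fscale c p)) = coset (fscale c x)" by blast
      then show ?thesis by (simp add: uea_simps uea_smult_def flip: coset_def)
    qed
  qed
qed

sublocale U: algebra_presentation fscale "uea UNIV" coset
  by (rule uea_presentation)

text \<open>The trace of the ideal of \<open>U(L)\<close> on the free algebra over \<open>M\<close> is an ideal that contains the
  relations of \<open>U(M)\<close>.\<close>

lemma uea_ideal_subset:
  assumes M: "lie_subalgebra M"
  shows "uea_ideal M \<subseteq> uea_ideal UNIV"
proof -
  let ?K = "uea_ideal UNIV \<inter> carrier (free_algebra M)"
  have "ideal ?K (free_algebra M)"
  proof (rule ideal_free_algebraI)
    show "free.subspace ?K"
      using free.subspace_inter[OF subspace_uea_ideal subspace_supported_on] by simp
    fix p q :: "'l free_word \<Rightarrow>\<^sub>0 'f"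
    assume "p \<in> ?K" "q \<in> carrier (free_algebra M)"
    then show "q * p \<in> ?K \<and> p * q \<in> ?K"
      using uea_ideal_mult by (auto elim!: supported_on_mult)
  qed simp
  moreover have "uea_relations M \<subseteq> ?K"
  proof -
    have "uea_relations M \<subseteq> uea_relations UNIV" unfolding uea_relations_def by blast
    then show ?thesis
      using uea_relations_in_ideal[OF lie_subalgebra_UNIV] uea_relations_subset[OF M] by blast
  qed
  ultimately have "uea_ideal M \<subseteq> ?K" by (rule uea_ideal_minimal)
  then show ?thesis by blast
qed

text \<open>With this description, \<open>U(M)\<close> itself disappears from the argument.\<close>

lemma uea_image_eq:
  assumes M: "lie_subalgebra M"
  shows "uea_image M = coset ` supported_on (\<lambda>w. set w \<subseteq> M)"
proof -
  have "uea_embed M (uea_ideal M +>\<^bsub>free_algebra M\<^esub> p) = coset p" for p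
  proof -
    have "coset q = coset p" if q: "q \<in> uea_ideal M +>\<^bsub>free_algebra M\<^esub> p" for q
    proof -
      obtain i where "i \<in> uea_ideal M" "q = i + p" using q by (auto simp: a_r_coset_def')
      then show ?thesis using uea_ideal_subset[OF M] by (auto simp: coset_eq_iff)
    qed
    moreover have "p \<in> uea_ideal M +>\<^bsub>free_algebra M\<^esub> p"
    proof -
      have "0 \<in> uea_ideal M"
        by (rule free.subspace_0[OF ideal_free_algebra_subspace[OF ideal_uea_ideal[OF M]]])
      then show ?thesis by (force simp: a_r_coset_def')
    qed
    ultimately have "(\<Union>q\<in>uea_ideal M +>\<^bsub>free_algebra M\<^esub> p. coset q) = coset p" by blast
    then show ?thesis by (simp add: uea_embed_def flip: coset_def)
  qed
  then show ?thesis
    unfolding uea_image_def by (auto simp: uea_simps A_RCOSETS_def' image_iff)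
qed

lemma coset_bracket: "coset (gen (bracket x y)) = coset (gen x * gen y - gen y * gen x)"
  using free.subspace_neg[OF subspace_uea_ideal gen_bracket_relation, of x y]
  by (simp add: coset_eq_iff)

lemma subspace_coset_gen_vimage:
  assumes "assoc_subspace (uea UNIV) W"
  shows "subspace {x. coset (gen x) \<in> W}"
proof -
  have W: "free.subspace (coset -` W)" using assms by (simp add: U.assoc_subspace_iff)
  have scale: "coset (gen (scale c x)) = coset (fscale c (gen x))" for c x
    by (simp add: coset_eq_iff gen_scale_relation)
  show ?thesis
  proof (rule subspaceI)
    show "0 \<in> {x. coset (gen x) \<in> W}"
      using scale[of 0 0] free.subspace_0[OF W] by simp
    fix x y assume xy: "x \<in> {x. coset (gen x) \<in> W}" "y \<in> {x. coset (gen x) \<in> W}"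
    have "coset (gen (x + y)) = coset (gen x + gen y)"
      by (simp add: coset_eq_iff gen_add_relation)
    then show "x + y \<in> {x. coset (gen x) \<in> W}"
      using free.subspace_add[OF W, of "gen x" "gen y"] xy by simp
    show "scale c x \<in> {x. coset (gen x) \<in> W}" for c
      using free.subspace_scale[OF W, of "gen x" c] xy by (simp add: scale)
  qed
qed

lemma assoc_subalgebra_uea_image:
  assumes M: "lie_subalgebra M"
  shows "assoc_subalgebra (uea UNIV) (uea_image M)"
  unfolding uea_image_eq[OF M] U.assoc_subalgebra_iff
proof (intro conjI allI impI)
  show "coset ` supported_on (\<lambda>w. set w \<subseteq> M) \<subseteq> range coset" by blast
  show "free.subspace (coset -` coset ` supported_on (\<lambda>w. set w \<subseteq> M))"
    using U.assoc_subspace_image[OF subspace_supported_on] by (simp add: U.assoc_subspace_iff)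
  show "coset 1 \<in> coset ` supported_on (\<lambda>w. set w \<subseteq> M)"
    by (intro imageI) (simp flip: monomial_Nil)
  fix x y assume "coset x \<in> coset ` supported_on (\<lambda>w. set w \<subseteq> M)"
    "coset y \<in> coset ` supported_on (\<lambda>w. set w \<subseteq> M)"
  then obtain p q where pq: "coset x = coset p" "coset y = coset q"
    "p \<in> supported_on (\<lambda>w. set w \<subseteq> M)" "q \<in> supported_on (\<lambda>w. set w \<subseteq> M)" by blast
  have "coset (x * y) = coset (p * q)" by (simp add: U.\<pi>_mult pq)
  moreover have "p * q \<in> supported_on (\<lambda>w. set w \<subseteq> M)"
    by (rule supported_on_mult[OF pq(3,4)]) auto
  ultimately show "coset (x * y) \<in> coset ` supported_on (\<lambda>w. set w \<subseteq> M)" by blast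
qed

text \<open>In a subalgebra \<open>W\<close> of \<open>U(L)\<close>, the elements of \<open>L\<close> whose coset lies in \<open>W\<close> form a Lie
  subalgebra; if it contains \<open>Y\<close>, then it contains \<open>M\<close>.\<close>

lemma assoc_generates_uea_image:
  assumes M: "lie_subalgebra M" and Y: "lie_generates Y M"
  shows "assoc_generates (uea UNIV) (coset ` gen ` Y) (uea_image M)"
  unfolding assoc_generates_def
proof (rule hull_unique)
  show "coset ` gen ` Y \<subseteq> uea_image M"
    using lie_generatesD(1)[OF Y M] by (auto simp: uea_image_eq[OF M] gen_eq_monomial)
  show "assoc_subalgebra (uea UNIV) (uea_image M)" by (rule assoc_subalgebra_uea_image[OF M])
  fix W assume YW: "coset ` gen ` Y \<subseteq> W" and W: "assoc_subalgebra (uea UNIV) W"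
  have W': "free.subspace (coset -` W)" "coset 1 \<in> W"
    "\<And>x y. coset x \<in> W \<Longrightarrow> coset y \<in> W \<Longrightarrow> coset (x * y) \<in> W"
    using W by (auto simp: U.assoc_subalgebra_iff)
  have "lie_subalgebra {x. coset (gen x) \<in> W}"
    unfolding lie_subalgebra_def
  proof (intro conjI ballI)
    show "subspace {x. coset (gen x) \<in> W}"
      using W by (intro subspace_coset_gen_vimage) (simp add: assoc_subalgebra_def)
    fix x y assume "x \<in> {x. coset (gen x) \<in> W}" "y \<in> {x. coset (gen x) \<in> W}"
    then have "gen x * gen y - gen y * gen x \<in> coset -` W"
      by (intro free.subspace_diff[OF W'(1)]) (auto intro: W'(3))
    then show "bracket x y \<in> {x. coset (gen x) \<in> W}" by (simp add: coset_bracket)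
  qed
  then have "lie_subalgebra hull Y \<subseteq> {x. coset (gen x) \<in> W}"
    using YW by (intro hull_minimal) auto
  then have gen: "coset (gen x) \<in> W" if "x \<in> M" for x using that Y by (auto simp: lie_generates_def)
  have words: "coset (monomial w) \<in> W" if "set w \<subseteq> M" for w
    using that by (induction w) (auto simp: monomial_Nil monomial_Cons W'(2) gen intro: W'(3))
  have "supported_on (\<lambda>w. set w \<subseteq> M) \<subseteq> coset -` W"
  proof
    fix p assume p: "p \<in> (supported_on (\<lambda>w. set w \<subseteq> M) :: ('l free_word \<Rightarrow>\<^sub>0 'f) set)"
    show "p \<in> coset -` W"
      by (rule in_free_subspaceI[OF W'(1)]) (use supported_onD[OF p] words in auto)
  qed
  then show "uea_image M \<subseteq> W" by (auto simp: uea_image_eq[OF M])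
qed

lemma uea_image_UNIV: "uea_image UNIV = carrier (uea UNIV)"
  by (simp add: uea_image_eq[OF lie_subalgebra_UNIV] U.carrier_eq)

text \<open>A commutator of length \<open>k\<close> expands to products of \<open>k\<close> generators, since \<open>[x,y] = x y - y x\<close> in
  \<open>U(L)\<close>.\<close>

lemma coset_gen_in_filt:
  assumes "x \<in> lie_filt Y n"
  shows "coset (gen x) \<in> coset ` U.word_filt (gen ` Y) n"
  using assms unfolding lie_filt_def
proof (rule span_induct)
  show "subspace {x. coset (gen x) \<in> coset ` U.word_filt (gen ` Y) n}"
    by (intro subspace_coset_gen_vimage U.assoc_subspace_image U.subspace_word_filt)
  have comm: "coset (gen x) \<in> coset ` U.word_filt (gen ` Y) k" if "lie_commutator Y k x" for k x
    using that
  proof induction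
    case (generator x)
    then show ?case using U.prod_list_in_word_filt[of "[gen x]" "gen ` Y" 1] by (intro imageI) simp
  next
    case (bracket m x n y)
    then obtain p q where pq: "coset (gen x) = coset p" "coset (gen y) = coset q"
      "p \<in> U.word_filt (gen ` Y) m" "q \<in> U.word_filt (gen ` Y) n" by blast
    have "gen x * gen y - gen y * gen x - (p * q - q * p)
      = (gen x - p) * gen y + p * (gen y - q) - ((gen y - q) * gen x + q * (gen x - p))"
      by (simp add: left_diff_distrib right_diff_distrib)
    also have "\<dots> \<in> uea_ideal UNIV"
    proof -
      have "gen x - p \<in> uea_ideal UNIV" "gen y - q \<in> uea_ideal UNIV"
        using pq by (simp_all add: coset_eq_iff)
      then show ?thesis
        by (intro free.subspace_diff[OF subspace_uea_ideal free.subspace_add[OF subspace_uea_ideal]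
              free.subspace_add[OF subspace_uea_ideal]] uea_ideal_mult)
    qed
    finally have "coset (gen (bracket x y)) = coset (p * q - q * p)"
      by (simp only: coset_bracket coset_eq_iff)
    moreover have "p * q - q * p \<in> U.word_filt (gen ` Y) (m + n)"
      using U.word_filt_mult[OF pq(3,4)] U.word_filt_mult[OF pq(4,3)]
      by (intro free.subspace_diff[OF U.subspace_word_filt]) (simp_all add: add.commute)
    ultimately show ?case by blast
  qed
  fix x assume "x \<in> {x. \<exists>k\<le>n. lie_commutator Y k x}"
  then obtain k where "k \<le> n" "lie_commutator Y k x" by blast
  then show "coset (gen x) \<in> coset ` U.word_filt (gen ` Y) n"
    using comm U.word_filt_mono[of k n "gen ` Y"] by blast
qed

lemma coset_monomial_in_filt:
  assumes "list_all2 (\<lambda>x k. x \<in> lie_filt Y k) xs ks"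
  shows "coset (monomial xs) \<in> coset ` U.word_filt (gen ` Y) (sum_list ks)"
  using assms
proof (induction rule: list_all2_induct)
  case Nil
  then show ?case using U.one_in_word_filt[of "gen ` Y" 0] by (auto simp: monomial_Nil)
next
  case (Cons x xs k ks)
  then obtain p q where pq: "coset (gen x) = coset p" "coset (monomial xs) = coset q"
    "p \<in> U.word_filt (gen ` Y) k" "q \<in> U.word_filt (gen ` Y) (sum_list ks)"
    using coset_gen_in_filt[of x Y k] by blast
  have "coset (monomial (x # xs)) = coset (p * q)"
    by (simp add: monomial_Cons U.\<pi>_mult pq)
  moreover have "p * q \<in> U.word_filt (gen ` Y) (sum_list (k # ks))"
    using U.word_filt_mult[OF pq(3,4)] by simp
  ultimately show ?case by blast
qed

end

context ordered_lie_basis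
begin

lemma pbw_coset: "coset p = coset q \<Longrightarrow> pbw p = pbw q"
  using pbw_uea_ideal[of "p - q"] by (simp add: coset_eq_iff pbw_diff)

lemma coset_pbw: "coset (pbw p) = coset p"
  by (simp add: coset_eq_iff pbw_congruent)

text \<open>The elements of \<open>Y\<close> have degree at most \<open>1\<close> in the filtration of the Lie algebra, so that a product of at most
  \<open>n\<close> of them has weight at most \<open>n\<close>.\<close>

lemma pbw_filt_weighted:
  assumes V: "adapted (lie_filt Y)" and p: "coset p \<in> coset ` U.word_filt (gen ` Y) n"
  shows "pbw p \<in> supported_on (weighted (lie_filt Y) n)"
proof -
  obtain q where q: "coset p = coset q" "q \<in> U.word_filt (gen ` Y) n" using p by blast
  have "U.word_filt (gen ` Y) n \<subseteq> {q. pbw q \<in> supported_on (weighted (lie_filt Y) n)}"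
    unfolding U.word_filt_def
  proof (rule free.span_minimal[OF _ subspace_pbw_vimage[OF subspace_supported_on]], rule subsetI)
    fix z :: "'l free_word \<Rightarrow>\<^sub>0 'f"
    assume "z \<in> {prod_list xs | xs. set xs \<subseteq> gen ` Y \<and> length xs \<le> n}"
    then obtain xs where xs: "z = prod_list xs" "set xs \<subseteq> gen ` Y" "length xs \<le> n" by blast
    then have "xs \<in> lists (gen ` Y)" by auto
    then obtain ys where ys: "xs = map gen ys" "set ys \<subseteq> Y"
      unfolding lists_image by auto
    have "Y \<subseteq> lie_filt Y 1"
      using lie_commutator_in_lie_filt[OF lie_commutator.generator, of _ Y 1] by blast
    then have "list_all2 (\<lambda>x k. x \<in> lie_filt Y k) ys (replicate (length ys) 1)"
      using ys(2) by (intro list_all2_all_nthI) (simp_all add: subset_iff)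
    then have "pbw (monomial ys) \<in> supported_on (weighted (lie_filt Y) n)"
      by (rule pbw_weighted[OF V]) (use ys xs in \<open>simp add: sum_list_replicate\<close>)
    then show "z \<in> {q. pbw q \<in> supported_on (weighted (lie_filt Y) n)}"
      using xs ys by (simp add: monomial_eq_prod_list)
  qed
  then show ?thesis using q(2) pbw_coset[OF q(1)] by auto
qed

end

section \<open>The distortion of enveloping algebras\<close>

lemma strict_total_order_exists:
  "\<exists>lt :: 'a \<Rightarrow> 'a \<Rightarrow> bool. irreflp lt \<and> transp lt \<and> totalp lt"
proof -
  obtain r :: "'a rel" where r: "Well_order r" "Field r = UNIV"
    using well_ordering[where 'a = 'a] by (elim exE conjE)
  have "well_order_on UNIV r" using r(1) unfolding r(2) .
  then have r: "trans r" "antisym r" "total r"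
    unfolding order_on_defs by blast+
  let ?lt = "\<lambda>a b. (a, b) \<in> r \<and> a \<noteq> b"
  have "irreflp ?lt" by (simp add: irreflp_def)
  moreover have "transp ?lt"
  proof (rule transpI)
    fix a b c assume "(a, b) \<in> r \<and> a \<noteq> b" "(b, c) \<in> r \<and> b \<noteq> c"
    then show "(a, c) \<in> r \<and> a \<noteq> c"
      using transD[OF r(1), of a b c] antisymD[OF r(2), of a b] by blast
  qed
  moreover have "totalp ?lt"
    using r(3) unfolding total_on_def totalp_on_def by blast
  ultimately show ?thesis by blast
qed

context lie_algebra
begin

lemma ordered_lie_basis_exists:
  assumes "independent B" "span B = UNIV"
  obtains lt where "ordered_lie_basis scale bracket B lt"
proof -
  obtain lt :: "'l \<Rightarrow> 'l \<Rightarrow> bool" where lt: "irreflp lt" "transp lt" "totalp lt"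
    using strict_total_order_exists by blast
  have "ordered_lie_basis_axioms scale B lt"
  proof (rule ordered_lie_basis_axioms.intro[OF assms])
    show "\<not> lt a a" for a using lt(1) by (rule irreflpD)
    show "lt a c" if "lt a b" "lt b c" for a b c using lt(2) that by (rule transpD)
    show "lt a b \<or> a = b \<or> lt b a" for a b using totalpD[OF lt(3), of a b] by blast
  qed
  with lie_algebra_axioms have "ordered_lie_basis scale bracket B lt"
    by (rule ordered_lie_basis.intro)
  then show ?thesis by (rule that)
qed

text \<open>The upper bound for the distortion. The basis is built in two stages: a basis \<open>C\<close> of \<open>M\<close> adapted
  to the subspaces \<open>M \<inter> L\<^sub>n\<close>, then a basis \<open>B\<close> of \<open>L\<close> adapted to the \<open>L\<^sub>n\<close> that contains \<open>C\<close>. The normal form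
  of an element of \<open>U(M) \<inter> U(L)\<^sub>n\<close> is controlled by both filtrations at once.\<close>

lemma uea_image_inter_filt_subset:
  assumes M: "lie_subalgebra M"
    and X: "lie_generates X UNIV" and Y: "lie_generates Y M"
    and d: "\<And>k. M \<inter> lie_filt X k \<subseteq> lie_filt Y (d k)"
  shows "uea_image M \<inter> coset ` U.word_filt (gen ` X) n \<subseteq>
    coset ` U.word_filt (gen ` Y) (superadd_closure d n)"
proof
  let ?L = "lie_filt X"
  have subM: "subspace M" using M by (simp add: lie_subalgebra_def)
  obtain C where C: "independent C" "\<And>n. M \<inter> ?L n \<subseteq> span (C \<inter> (M \<inter> ?L n))" "C \<subseteq> (\<Union>n. M \<inter> ?L n)"
  proof (rule adapted_basis_exists[where V = "\<lambda>n. M \<inter> ?L n" and T = "\<lambda>n. {}"])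
    show "subspace (M \<inter> ?L n)" for n by (rule subspace_inter[OF subM subspace_lie_filt])
    show "M \<inter> ?L n \<subseteq> M \<inter> ?L (Suc n)" for n using lie_filt_mono[of n "Suc n"] by auto
    show "M \<inter> ?L 0 = {0}" using subspace_0[OF subM] by (simp add: lie_filt_0)
  qed (auto intro: that)
  obtain B where B: "independent B" "\<And>n. ?L n \<subseteq> span (B \<inter> ?L n)"
    "\<And>n. C \<inter> ?L (Suc n) - ?L n \<subseteq> B"
  proof (rule adapted_basis_exists[where V = ?L and T = "\<lambda>n. C \<inter> ?L (Suc n) - ?L n"])
    fix n S assume S: "independent S" "span S = ?L n"
    let ?T = "C \<inter> ?L (Suc n) - ?L n"
    show "independent (S \<union> ?T)"
    proof (rule independent_Un_disjoint_spans[OF S(1)])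
      show "independent ?T" using C(1) by (rule independent_mono) auto
      \<comment> \<open>An element of \<open>M \<inter> L\<^sub>n\<close> is a combination of members of \<open>C\<close> inside \<open>L\<^sub>n\<close>, none of which is in the seed set.\<close>
      have "span ?T \<subseteq> M" using C(3) by (intro span_minimal[OF _ subM]) auto
      then have "span S \<inter> span ?T \<subseteq> span (C \<inter> (M \<inter> ?L n)) \<inter> span ?T"
        using C(2)[of n] S(2) by blast
      also have "\<dots> \<subseteq> {0}"
        by (rule span_disjoint_subsets_of_independent[OF C(1)]) auto
      finally show "span S \<inter> span ?T \<subseteq> {0}" .
    qed
  qed (auto simp: subspace_lie_filt lie_filt_0 intro: that lie_filt_mono[THEN subsetD, rotated])
  have CB: "C \<subseteq> B"
  proof
    fix c assume c: "c \<in> C"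
    then have "\<exists>n. c \<in> ?L n" using C(3) by blast
    then obtain n where n: "c \<in> ?L n" "\<And>k. k < n \<Longrightarrow> c \<notin> ?L k"
      using exists_least_iff[of "\<lambda>n. c \<in> ?L n"] by blast
    have "c \<noteq> 0" using c C(1) dependent_zero by blast
    then obtain k where "n = Suc k" using n(1) by (cases n) (auto simp: lie_filt_0)
    then show "c \<in> B" using n c B(3)[of k] by auto
  qed
  have span_B: "span B = UNIV"
  proof -
    have "?L n \<subseteq> span B" for n using B(2)[of n] span_mono[of "B \<inter> ?L n" B] by blast
    then show ?thesis using lie_generatesD(2)[OF X lie_subalgebra_UNIV] by blast
  qed
  obtain lt where "ordered_lie_basis scale bracket B lt"
    by (rule ordered_lie_basis_exists[OF B(1) span_B])
  then interpret O: ordered_lie_basis scale bracket B lt .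
  have adapted_L: "O.adapted ?L"
    using lie_filt_mono lie_filt_bracket B(2) unfolding O.adapted_def by blast
  have adapted_M: "O.adapted (\<lambda>_. M)"
  proof -
    have "M \<subseteq> span (B \<inter> M)"
    proof
      fix x assume "x \<in> M"
      then obtain n where "x \<in> M \<inter> ?L n" using lie_generatesD(2)[OF X lie_subalgebra_UNIV] by blast
      then have "x \<in> span (C \<inter> (M \<inter> ?L n))" using C(2) by blast
      then show "x \<in> span (B \<inter> M)" using span_mono[of "C \<inter> (M \<inter> ?L n)" "B \<inter> M"] CB by blast
    qed
    then show ?thesis using M by (auto simp: O.adapted_def lie_subalgebra_def)
  qed
  fix z assume z: "z \<in> uea_image M \<inter> coset ` U.word_filt (gen ` X) n"
  then obtain p where p: "z = coset p" "p \<in> supported_on (\<lambda>w. set w \<subseteq> M)"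
    by (auto simp: uea_image_eq[OF M])
  have inL: "O.pbw p \<in> supported_on (O.weighted ?L n)"
    by (rule O.pbw_filt_weighted[OF adapted_L]) (use z p in auto)
  have inM: "O.pbw p \<in> supported_on (O.weighted (\<lambda>_. M) 0)"
  proof -
    have "p \<in> {p. O.pbw p \<in> supported_on (O.weighted (\<lambda>_. M) 0)}"
    proof (rule in_free_subspaceI[OF O.subspace_pbw_vimage[OF subspace_supported_on]])
      fix w assume "Word w \<in> Poly_Mapping.keys p"
      then have "set w \<subseteq> M" by (rule supported_onD[OF p(2)])
      then have "list_all2 (\<lambda>x k. x \<in> M) w (replicate (length w) (0 :: nat))"
        by (auto simp: list_all2_conv_all_nth)
      then show "monomial w \<in> {p. O.pbw p \<in> supported_on (O.weighted (\<lambda>_. M) 0)}"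
        using O.pbw_weighted[OF adapted_M, of w "replicate (length w) 0" 0] by (simp add: sum_list_replicate)
    qed
    then show ?thesis by simp
  qed
  let ?G = "\<lambda>n. coset ` U.word_filt (gen ` Y) n"
  have "O.pbw p \<in> coset -` ?G (superadd_closure d n)"
  proof (rule in_free_subspaceI)
    show "free.subspace (coset -` ?G (superadd_closure d n))"
      using U.assoc_subspace_image[OF U.subspace_word_filt] by (simp add: U.assoc_subspace_iff)
    fix w assume w: "Word w \<in> Poly_Mapping.keys (O.pbw p)"
    have wL: "O.weighted ?L n w" and wM: "O.weighted (\<lambda>_. M) 0 w"
      using supported_onD[OF inL w] supported_onD[OF inM w] .
    let ?ks = "map (weight ?L) w"
    have mem: "x \<in> M \<inter> ?L (weight ?L x)" if "x \<in> set w" for x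
    proof -
      have "x \<in> (\<Union>k. ?L k)" "x \<in> M" using that wL wM by (auto simp: O.weighted_def)
      then show ?thesis using weight_mem[of x ?L] by blast
    qed
    \<comment> \<open>Superadditive closure admits positive parts only; basis elements are nonzero and \<open>L\<^sub>0 = 0\<close>.\<close>
    have pos: "0 < weight ?L x" if "x \<in> set w" for x
    proof (rule ccontr)
      assume "\<not> 0 < weight ?L x"
      then have "x = 0" using mem[OF that] by (simp add: lie_filt_0)
      moreover have "x \<in> B" using that wL by (auto simp: O.weighted_def)
      ultimately show False using B(1) dependent_zero by blast
    qed
    have "list_all2 (\<lambda>x k. x \<in> lie_filt Y k) w (map d ?ks)"
      using mem d by (fastforce simp: list_all2_conv_all_nth)
    then have "coset (monomial w) \<in> ?G (sum_list (map d ?ks))" by (rule coset_monomial_in_filt)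
    moreover have "sum_list (map d ?ks) \<le> superadd_closure d (sum_list ?ks)"
      by (rule sum_le_superadd_closure) (use pos in auto)
    moreover have "superadd_closure d (sum_list ?ks) \<le> superadd_closure d n"
      using wL by (intro superadd_closure_mono) (simp add: O.weighted_def)
    ultimately show "monomial w \<in> coset -` ?G (superadd_closure d n)"
      using U.word_filt_mono[of "sum_list (map d ?ks)" "superadd_closure d n" "gen ` Y"] by auto
  qed
  then show "z \<in> ?G (superadd_closure d n)" by (simp add: O.coset_pbw p)
qed

text \<open>The lower bound for the distortion: any degree \<open>m\<close> that works for \<open>U(M) \<inter> U(L)\<^sub>n\<close> is at least
  the sum of the values of \<open>d\<close> over a partition of \<open>n\<close>, witnessed by a sorted product of elements that
  realise these values.\<close>

lemma superadd_closure_le_uea_degree: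
  assumes M: "lie_subalgebra M"
    and X: "lie_generates X UNIV" and Y: "lie_generates Y M"
    and d: "\<And>k. M \<inter> lie_filt X k \<subseteq> lie_filt Y (d k)"
    and d_least: "\<And>k m. M \<inter> lie_filt X k \<subseteq> lie_filt Y m \<Longrightarrow> d k \<le> m"
    and m: "uea_image M \<inter> coset ` U.word_filt (gen ` X) n \<subseteq> coset ` U.word_filt (gen ` Y) m"
  shows "superadd_closure d n \<le> m"
proof -
  let ?L = "lie_filt X" and ?N = "lie_filt Y"
  have "\<exists>x. x \<in> ?N (Suc v) \<and> x \<notin> ?N v \<and> (\<forall>k. d k = Suc v \<longrightarrow> x \<in> M \<inter> ?L k)"
    if v: "Suc v \<in> range d" for v
  proof -
    have "\<exists>k. d k = Suc v" using v by (elim rangeE) (blast intro: sym)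
    \<comment> \<open>The first index with this value: a witness in \<open>L\<^sub>k\<close> lies in all later \<open>L\<^sub>j\<close>.\<close>
    then obtain k where k: "d k = Suc v" "\<And>j. j < k \<Longrightarrow> d j \<noteq> Suc v"
      using exists_least_iff[of "\<lambda>k. d k = Suc v"] by blast
    have "\<not> M \<inter> ?L k \<subseteq> ?N v" using d_least[of k v] k(1) by auto
    then obtain x where x: "x \<in> M" "x \<in> ?L k" "x \<notin> ?N v" by blast
    moreover have "x \<in> ?N (Suc v)" using d[of k] x k(1) by auto
    moreover have "x \<in> ?L j" if "d j = Suc v" for j
      using x(2) lie_filt_mono[of k j X] k(2)[of j] that by (cases "j < k") auto
    ultimately show ?thesis by blast
  qed
  then have "\<forall>v. \<exists>x. Suc v \<in> range d \<longrightarrow>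
      x \<in> ?N (Suc v) \<and> x \<notin> ?N v \<and> (\<forall>k. d k = Suc v \<longrightarrow> x \<in> M \<inter> ?L k)"
    by blast
  from choice[OF this] obtain s where s: "\<And>v. Suc v \<in> range d \<Longrightarrow>
      s v \<in> ?N (Suc v) \<and> s v \<notin> ?N v \<and> (\<forall>k. d k = Suc v \<longrightarrow> s v \<in> M \<inter> ?L k)"
    by blast
  have s_mem: "s v \<in> M \<inter> ?L k" if k: "d k = Suc v" for v k
  proof -
    have "Suc v \<in> range d" using k by (intro range_eqI[of _ _ k]) simp
    then show ?thesis using s k by blast
  qed
  \<comment> \<open>The element \<open>s v\<close> realises the value \<open>v + 1\<close> of \<open>d\<close>, and is a seed at the step from \<open>v\<close> to \<open>v + 1\<close>.\<close>
  define T where "T v = (if Suc v \<in> range d then {s v} else {})" for v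
  obtain C where C: "independent C" "\<And>n. ?N n \<subseteq> span (C \<inter> ?N n)" "\<And>n. T n \<subseteq> C"
  proof (rule adapted_basis_exists[where V = ?N and T = T])
    fix n S assume S: "independent S" "span S = ?N n"
    have "independent (insert (s n) S)" if "Suc n \<in> range d"
    proof (rule independent_insertI[OF _ S(1)])
      show "s n \<notin> span S" unfolding S(2) using s[OF that] by blast
    qed
    then show "independent (S \<union> T n)" using S(1) by (cases "Suc n \<in> range d") (simp_all add: T_def)
  qed (use s in \<open>auto simp: subspace_lie_filt lie_filt_0 T_def intro: that lie_filt_mono[THEN subsetD, rotated]\<close>)
  obtain B where B: "C \<subseteq> B" "independent B" "UNIV \<subseteq> span B"
    by (rule maximal_independent_subset_extend[OF subset_UNIV C(1)])
  have span_B: "span B = UNIV" using B(3) by (rule equalityI[OF subset_UNIV])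
  obtain lt where "ordered_lie_basis scale bracket B lt"
    by (rule ordered_lie_basis_exists[OF B(2) span_B])
  then interpret O: ordered_lie_basis scale bracket B lt .
  have "?N n \<subseteq> span (B \<inter> ?N n)" for n
    using C(2)[of n] span_mono[of "C \<inter> ?N n" "B \<inter> ?N n"] B(1) by blast
  then have adapted: "O.adapted ?N"
    using lie_filt_mono lie_filt_bracket unfolding O.adapted_def by blast
  obtain ns where ns: "\<forall>k\<in>set ns. 0 < k" "sum_list ns = n" "superadd_closure d n = sum_list (map d ns)"
    by (rule superadd_closure_attained)
  \<comment> \<open>Parts on which \<open>d\<close> vanishes contribute nothing to the sum and have no witness.\<close>
  define ks where "ks = filter (\<lambda>k. 0 < d k) ns"
  define t where "t k = s (d k - 1)" for k
  have t: "t k \<in> B" "t k \<in> M \<inter> ?L k" "weight ?N (t k) = d k" if k: "k \<in> set ks" for k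
  proof -
    obtain v where v: "d k = Suc v" using k by (cases "d k") (auto simp: ks_def)
    then have r: "Suc v \<in> range d" by (intro range_eqI[of _ _ k]) simp
    then show "t k \<in> B" using B(1) C(3)[of v] v by (auto simp: T_def t_def)
    show "t k \<in> M \<inter> ?L k" using s_mem[OF v] v by (simp add: t_def)
    have "weight ?N (s v) = Suc v"
      unfolding weight_def
    proof (rule Least_equality)
      show "s v \<in> ?N (Suc v)" using s[OF r] by blast
      fix j assume "s v \<in> ?N j"
      then show "Suc v \<le> j" using s[OF r] lie_filt_mono[of j v Y] by (cases "j \<le> v") auto
    qed
    then show "weight ?N (t k) = d k" using v by (simp add: t_def)
  qed
  \<comment> \<open>Sorted, the product is its own normal form; weights do not depend on the order.\<close>
  obtain w where w: "mset w = mset (map t ks)" "\<not> O.has_descent w"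
    by (rule O.exists_descent_free_permutation)
  have set_w: "set w = t ` set ks" using mset_eq_setD[OF w(1)] by simp
  have sum_w: "sum_list (map f w) = sum_list (map f (map t ks))" for f :: "'l \<Rightarrow> nat"
  proof -
    have "mset (map f w) = mset (map f (map t ks))" by (simp only: mset_map w(1))
    then show ?thesis by (simp only: sum_mset_sum_list[symmetric])
  qed
  have "coset (monomial w) \<in> coset ` U.word_filt (gen ` X) n"
  proof -
    have "x \<in> ?L (weight ?L x)" if "x \<in> set w" for x
    proof (rule weight_mem)
      show "x \<in> (\<Union>k. ?L k)" using that t(2) unfolding set_w by blast
    qed
    then have "list_all2 (\<lambda>x k. x \<in> ?L k) w (map (weight ?L) w)"
      by (simp add: list_all2_conv_all_nth)
    then have "coset (monomial w) \<in> coset ` U.word_filt (gen ` X) (sum_list (map (weight ?L) w))"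
      by (rule coset_monomial_in_filt)
    moreover have "sum_list (map (weight ?L) w) \<le> n"
    proof -
      have "sum_list (map (weight ?L) (map t ks)) \<le> sum_list ks"
        using sum_list_mono[of ks "weight ?L \<circ> t" "\<lambda>k. k"] t(2) by (simp add: weight_le o_def)
      also have "\<dots> \<le> sum_list ns"
        unfolding ks_def using sum_list_filter_le_nat[of "\<lambda>k. k" _ ns] by simp
      finally show ?thesis using ns(2) sum_w by simp
    qed
    ultimately show ?thesis using U.word_filt_mono[of "sum_list (map (weight ?L) w)" n] by blast
  qed
  moreover have "coset (monomial w) \<in> uea_image M"
    unfolding uea_image_eq[OF M] by (intro imageI) (use set_w t(2) in auto)
  ultimately have "coset (monomial w) \<in> coset ` U.word_filt (gen ` Y) m" using m by blast
  then have "O.pbw (monomial w) \<in> supported_on (O.weighted ?N m)"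
    by (rule O.pbw_filt_weighted[OF adapted])
  moreover have "O.pbw (monomial w) = monomial w"
    by (rule O.pbw_no_descent) (use set_w t(1) w(2) in auto)
  ultimately have "sum_list (map (weight ?N) w) \<le> m" by (simp add: O.weighted_def)
  also have "sum_list (map (weight ?N) w) = sum_list (map d ks)"
    using sum_w[of "weight ?N"] t(3) by (simp add: o_def cong: map_cong)
  also have "\<dots> = superadd_closure d n"
    unfolding ns(3) ks_def by (induction ns) auto
  finally show ?thesis .
qed

theorem assoc_dist_uea_image:
  assumes M: "lie_subalgebra M"
    and X: "finite X" "lie_generates X UNIV" and Y: "finite Y" "lie_generates Y M"
  shows "assoc_dist (uea UNIV) (uea_image M) =
    func_class (superadd_closure (distortion (lie_filt X) M (lie_filt Y)))"
proof -
  let ?d = "distortion (lie_filt X) M (lie_filt Y)"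
  let ?X = "coset ` gen ` X" and ?Y = "coset ` gen ` Y"
  have d: "M \<inter> lie_filt X k \<subseteq> lie_filt Y (?d k)" for k
    using lie_distortion_finite[OF X(1) Y(2) M, of k] distortionI by blast
  have upper: "uea_image M \<inter> assoc_filt (uea UNIV) ?X n \<subseteq> assoc_filt (uea UNIV) ?Y (superadd_closure ?d n)" for n
    unfolding U.assoc_filt_image by (rule uea_image_inter_filt_subset[OF M X(2) Y(2) d])
  have "distortion (assoc_filt (uea UNIV) ?X) (uea_image M) (assoc_filt (uea UNIV) ?Y) n = superadd_closure ?d n" for n
    unfolding distortion_def[of "assoc_filt (uea UNIV) ?X"]
  proof (rule Least_equality)
    fix m assume "uea_image M \<inter> assoc_filt (uea UNIV) ?X n \<subseteq> assoc_filt (uea UNIV) ?Y m"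
    then show "superadd_closure ?d n \<le> m"
      unfolding U.assoc_filt_image
      by (intro superadd_closure_le_uea_degree[OF M X(2) Y(2) d]) (rule distortion_least)
  qed (rule upper)
  then have eq: "distortion (assoc_filt (uea UNIV) ?X) (uea_image M) (assoc_filt (uea UNIV) ?Y) = superadd_closure ?d"
    by (rule ext)
  have "assoc_dist (uea UNIV) (uea_image M) =
      func_class (distortion (assoc_filt (uea UNIV) ?X) (uea_image M) (assoc_filt (uea UNIV) ?Y))"
  proof (rule U.assoc_dist_eq_func_class)
    show "assoc_generates (uea UNIV) ?X (carrier (uea UNIV))"
      using assoc_generates_uea_image[OF lie_subalgebra_UNIV X(2)] by (simp add: uea_image_UNIV)
    show "assoc_generates (uea UNIV) ?Y (uea_image M)"
      by (rule assoc_generates_uea_image[OF M Y(2)])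
    show "assoc_subalgebra (uea UNIV) (uea_image M)" by (rule assoc_subalgebra_uea_image[OF M])
  qed (use X Y upper in blast)+
  then show ?thesis by (simp only: eq)
qed

end

theorem theorem6:
  fixes scale :: "'f::field \<Rightarrow> 'l::ab_group_add \<Rightarrow> 'l"
    and bracket :: "'l \<Rightarrow> 'l \<Rightarrow> 'l"
    and M :: "'l set"
  assumes "lie_algebra scale bracket"
    and "\<exists>X. finite X \<and> lie_algebra.lie_generates scale bracket X UNIV"
    and "lie_algebra.lie_subalgebra scale bracket M"
    and "\<exists>Y. finite Y \<and> lie_algebra.lie_generates scale bracket Y M"
  shows "assoc_dist (lie_algebra.uea scale bracket UNIV) (lie_algebra.uea_image scale bracket M)
           = class_closure (lie_algebra.lie_dist scale bracket M) \<and>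
         (\<forall>f \<in> lie_algebra.lie_dist scale bracket M.
            assoc_dist (lie_algebra.uea scale bracket UNIV) (lie_algebra.uea_image scale bracket M)
              = func_class (superadd_closure f))"
proof -
  interpret lie_algebra scale bracket by fact
  obtain X Y where X: "finite X" "lie_generates X UNIV" and Y: "finite Y" "lie_generates Y M"
    using assms(2,4) by blast
  let ?d = "distortion (lie_filt X) M (lie_filt Y)"
  have dist: "lie_dist M = func_class ?d"
    by (rule lie_dist_eq_func_class[OF assms(3) X Y])
  have all: "assoc_dist (uea UNIV) (uea_image M) = func_class (superadd_closure f)"
    if "f \<in> lie_dist M" for f
  proof -
    have "func_equiv ?d f" using that by (simp add: dist func_class_def)
    then have "func_class (superadd_closure ?d) = func_class (superadd_closure f)"
      by (intro func_class_eqI func_equiv_superadd_closure)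
    then show ?thesis by (simp add: assoc_dist_uea_image[OF assms(3) X Y])
  qed
  moreover have "?d \<in> lie_dist M" by (simp add: dist func_class_self)
  ultimately have "assoc_dist (uea UNIV) (uea_image M) = class_closure (lie_dist M)"
    unfolding class_closure_def by blast
  with all show ?thesis by blast
qed

end
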